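(* (1) There exists an LS*$(1,2;2,(3,\{3,8\}),v)$ for every $v\equiv 8\pmod{12}$. (2) There exists an LS*$(1,2;2,(3,\{3,14,26,50,98\}),v)$ for every $v\equiv 2\pmod{12}$.
   Context: For a set $K$ of positive integers, an S$(\lambda;2,K,v)$ is a pair $(X,\mathcal{B})$ with $|X|=v$ and $\mathcal{B}$ a multiset of subsets of $X$ (blocks) with sizes in $K$ such that every 2-subset of $X$ lies in exactly $\lambda$ blocks (counted with multiplicity). An S$(3,K,v)$ is a pair $(X,\mathcal{B})$ with $\mathcal{B}$ a set of subsets of $X$ with sizes in $K$ such that every 3-subset of $X$ lies in exactly one block. An LS$(1,\lambda;2,(3,K),v)$ is a collection $(X,\mathcal{B}_r)_{r\in R}$ of S$(\lambda;2,K,v)$ on a common point set $X$ such that $(X,\bigcup_{r\in R}\mathcal{B}_r)$ (ordinary set union, not multiset union) is an S$(3,K,v)$ and each block $B$ of this union appears exactly $|B|-2$ times in the multiset $\{B: B\in\mathcal{B}_r, r\in R\}$. An LS*$(1,\lambda;2,(3,K),v)$ is such an LS with the additional property that for every $r\in R$ and every $B\in\mathcal{B}_r$ with $|B|\ge 4$, $B$ appears exactly $\lambda$ times in $\mathcal{B}_r$. *)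

theory Defs
  imports Main "HOL-Library.Multiset" "HOL-Number_Theory.Cong"
begin

text \<open>\<open>is_S2 l K v X \<B>\<close>: the pair \<open>(X, \<B>)\<close> is an S(l;2,K,v); blocks are counted
  with multiplicity.\<close>

definition is_S2 :: "nat \<Rightarrow> nat set \<Rightarrow> nat \<Rightarrow> 'a set \<Rightarrow> 'a set multiset \<Rightarrow> bool" where
  "is_S2 l K v X \<B> \<longleftrightarrow>
     0 \<notin> K \<and> finite X \<and> card X = v \<and>
     (\<forall>B. B \<in># \<B> \<longrightarrow> B \<subseteq> X \<and> card B \<in> K) \<and>
     (\<forall>P. P \<subseteq> X \<and> card P = 2 \<longrightarrow> size (filter_mset (\<lambda>B. P \<subseteq> B) \<B>) = l)"

text \<open>\<open>is_S3 K v X \<B>\<close>: the pair \<open>(X, \<B>)\<close> is an S(3,K,v); here \<open>\<B>\<close> is a plain set.\<close>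

definition is_S3 :: "nat set \<Rightarrow> nat \<Rightarrow> 'a set \<Rightarrow> 'a set set \<Rightarrow> bool" where
  "is_S3 K v X \<B> \<longleftrightarrow>
     0 \<notin> K \<and> finite X \<and> card X = v \<and>
     (\<forall>B\<in>\<B>. B \<subseteq> X \<and> card B \<in> K) \<and>
     (\<forall>T. T \<subseteq> X \<and> card T = 3 \<longrightarrow> (\<exists>!B. B \<in> \<B> \<and> T \<subseteq> B))"

text \<open>\<open>is_LS l K v X R \<B>\<close>: the family \<open>(X, \<B> r)\<close>, \<open>r \<in> R\<close>, is an LS(1,l;2,(3,K),v).
  Finiteness of \<open>R\<close> makes the multiset sum meaningful. The sum adds multiplicities, whereas
  the union of the \<open>set_mset (\<B> r)\<close> forgets them. The multiplicity \<open>card B - 2\<close> is stated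
  additively to avoid truncated subtraction.\<close>

definition is_LS ::
  "nat \<Rightarrow> nat set \<Rightarrow> nat \<Rightarrow> 'a set \<Rightarrow> 'i set \<Rightarrow> ('i \<Rightarrow> 'a set multiset) \<Rightarrow> bool" where
  "is_LS l K v X R \<B> \<longleftrightarrow>
     finite R \<and>
     (\<forall>r\<in>R. is_S2 l K v X (\<B> r)) \<and>
     is_S3 K v X (\<Union>r\<in>R. set_mset (\<B> r)) \<and>
     (\<forall>B \<in> (\<Union>r\<in>R. set_mset (\<B> r)). count (\<Sum>r\<in>R. \<B> r) B + 2 = card B)"

definition is_LS_star ::
  "nat \<Rightarrow> nat set \<Rightarrow> nat \<Rightarrow> 'a set \<Rightarrow> 'i set \<Rightarrow> ('i \<Rightarrow> 'a set multiset) \<Rightarrow> bool" where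
  "is_LS_star l K v X R \<B> \<longleftrightarrow>
     is_LS l K v X R \<B> \<and>
     (\<forall>r\<in>R. \<forall>B. B \<in># \<B> r \<and> card B \<ge> 4 \<longrightarrow> count (\<B> r) B = l)"

end

theory Submission
  imports Defs
begin

text \<open>Write \<open>v - 2 = g n\<close> and split all but two ideal points into \<open>n\<close> groups of even size \<open>g\<close>. It suffices to
  distribute the triples not contained in (ideal points + group) over \<open>g n / 2\<close> systems, \<open>g / 2\<close> for each
  group, such that a system covers each pair twice, except that it does not cover the pairs inside the ideal
  points and its own group: this long block is then filled with a system of a smaller LS* with \<open>g + 2\<close> points.
  Such a distribution is obtained by giving weight \<open>m = 2h\<close> to a small design of tagged triples and arcs:
  a triple with tag \<open>e\<close> is inflated by the equation \<open>x + y + z = 2s + e\<close> mod \<open>m\<close>, and an arc by zigzag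
  Hamiltonian paths, as in the Schreiber-Wilson construction. The small designs exist for \<open>n\<close>
  coprime to 6 (on \<open>\<int>\<close>/n: triples \<open>p + q + r = 3\<sigma>\<close>, arcs from \<open>p\<close> to \<open>3\<sigma> - 2p\<close>), for
  \<open>n = 3\<close> and for \<open>n = 4\<close> (cyclic examples on 9 and 8 points). Since one may multiply by 3, by 4 and by
  every number coprime to 6, the one-block systems with 8, 14 and 26 points suffice.\<close>

section \<open>Filling long blocks\<close>

lemma three_le_card_unique:
  assumes "card (L \<inter> M) \<le> 2" "finite L" "b \<subseteq> L" "b \<subseteq> M" "3 \<le> card b"
  shows False
  using card_mono[of "L \<inter> M" b] assms by auto

lemma count_image_mset_inj_on:
  assumes "inj_on g (insert x (set_mset M))"
  shows "count (image_mset g M) (g x) = count M x"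
proof -
  have "g -` {g x} \<inter> set_mset M = {x} \<inter> set_mset M"
    using assms by (auto simp: inj_on_def)
  then show ?thesis
    by (cases "x \<in># M") (auto simp: count_image_mset not_in_iff)
qed

lemma is_LS_star_fill:
  fixes X :: "'a set" and Y :: "'b set" and B :: "'q \<Rightarrow> 'b set multiset" and S :: "'j \<Rightarrow> 'a set set"
  assumes LS: "is_LS_star 2 K w Y Q B" and K: "3 \<in> K" "\<And>k. k \<in> K \<Longrightarrow> 3 \<le> k"
    and fin: "finite X" "finite J"
    and L: "\<And>i. i \<in> I \<Longrightarrow> L i \<subseteq> X" "\<And>i. i \<in> I \<Longrightarrow> card (L i) = w"
    and LL: "\<And>i i'. i \<in> I \<Longrightarrow> i' \<in> I \<Longrightarrow> i \<noteq> i' \<Longrightarrow> card (L i \<inter> L i') \<le> 2"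
    and rho: "\<And>j. j \<in> J \<Longrightarrow> \<rho> j \<in> I"
    and tau: "\<And>i. i \<in> I \<Longrightarrow> bij_betw \<tau> {j \<in> J. \<rho> j = i} Q"
    and S: "\<And>j b. j \<in> J \<Longrightarrow> b \<in> S j \<Longrightarrow> b \<subseteq> X \<and> card b = 3 \<and> (\<forall>i\<in>I. \<not> b \<subseteq> L i)"
    and pairs: "\<And>j P. j \<in> J \<Longrightarrow> P \<subseteq> X \<Longrightarrow> card P = 2 \<Longrightarrow>
                  card {b \<in> S j. P \<subseteq> b} = (if P \<subseteq> L (\<rho> j) then 0 else 2)"
    and triples: "\<And>t. t \<subseteq> X \<Longrightarrow> card t = 3 \<Longrightarrow> (\<And>i. i \<in> I \<Longrightarrow> \<not> t \<subseteq> L i) \<Longrightarrow> \<exists>!j. j \<in> J \<and> t \<in> S j"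
  shows "\<exists>B'. is_LS_star 2 K (card X) X J B'"
proof -
  define U where "U = (\<Union>q\<in>Q. set_mset (B q))"
  have LSd: "is_LS 2 K w Y Q B"
    and star: "\<And>q b. q \<in> Q \<Longrightarrow> b \<in># B q \<Longrightarrow> 4 \<le> card b \<Longrightarrow> count (B q) b = 2"
    using LS by (auto simp: is_LS_star_def)
  have S2: "is_S2 2 K w Y (B q)" if "q \<in> Q" for q using LSd that by (simp add: is_LS_def)
  have S3: "is_S3 K w Y U"
    and Ucount: "\<And>b. b \<in> U \<Longrightarrow> count (\<Sum>q\<in>Q. B q) b + 2 = card b"
    using LSd unfolding is_LS_def U_def by blast+
  have Y: "finite Y" "card Y = w" using S3 by (simp_all add: is_S3_def)
  have BK: "b \<subseteq> Y" "card b \<in> K" if "b \<in># B q" "q \<in> Q" for b q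
    using S2[OF that(2)] that(1) by (simp_all add: is_S2_def)
  have BP: "size (filter_mset (\<lambda>b. P \<subseteq> b) (B q)) = 2" if "q \<in> Q" "P \<subseteq> Y" "card P = 2" for P q
    using S2[OF that(1)] that(2,3) by (simp add: is_S2_def)
  have UT: "\<exists>!b. b \<in> U \<and> t \<subseteq> b" if "t \<subseteq> Y" "card t = 3" for t
    using S3 that by (simp add: is_S3_def)
  have Ucard: "3 \<le> card b" "b \<subseteq> Y" "card b \<in> K" if "b \<in> U" for b using BK K that unfolding U_def by blast+
  have finL: "finite (L i)" if "i \<in> I" for i using L fin that finite_subset by blast
  have "\<exists>g. bij_betw g Y (L i)" if "i \<in> I" for i
    using finite_same_card_bij[OF Y(1) finL[OF that]] Y L that by simp
  then obtain f where f: "\<And>i. i \<in> I \<Longrightarrow> bij_betw (f i) Y (L i)" by metis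
  have finj: "inj_on (f i) Y" and fim: "f i ` Y = L i" if "i \<in> I" for i
    using f[OF that] by (auto simp: bij_betw_def)
  have injP: "inj_on ((`) (f i)) (Pow Y)" if "i \<in> I" for i
    using finj[OF that] by (simp add: inj_on_image_Pow)
  have fss: "f i ` a \<subseteq> f i ` b \<longleftrightarrow> a \<subseteq> b" if "i \<in> I" "a \<subseteq> Y" "b \<subseteq> Y" for i a b
    using finj[OF that(1)] that(2,3) by (auto simp: inj_on_def subset_iff image_iff) blast
  have fcard: "card (f i ` b) = card b" if "i \<in> I" "b \<subseteq> Y" for i b
    using finj[OF that(1)] that(2) by (meson card_image inj_on_subset)
  have fsub: "f i ` b \<subseteq> L i" if "i \<in> I" "b \<subseteq> Y" for i b
    using fim[OF that(1)] that(2) by blast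
  have tauQ: "\<tau> j \<in> Q" if "j \<in> J" for j
    using tau[OF rho[OF that]] that by (auto simp: bij_betw_def)
  have tauU: "\<exists>j. j \<in> J \<and> \<rho> j = i \<and> \<tau> j = q" if "i \<in> I" "q \<in> Q" for i q
    using tau[OF that(1)] that(2) by (force simp: bij_betw_def)
  have finS: "finite (S j)" if "j \<in> J" for j
    by (rule finite_subset[of _ "Pow X"]) (use S[OF that] fin in auto)
  define B' where "B' j = mset_set (S j) + image_mset ((`) (f (\<rho> j))) (B (\<tau> j))" for j
  have setB': "set_mset (B' j) = S j \<union> (`) (f (\<rho> j)) ` set_mset (B (\<tau> j))" if "j \<in> J" for j
    using finS[OF that] by (simp add: B'_def)
  have BU: "b \<in> U" if "j \<in> J" "b \<in># B (\<tau> j)" for j b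
    using tauQ[OF that(1)] that(2) unfolding U_def by blast
  have union: "(\<Union>j\<in>J. set_mset (B' j)) = (\<Union>j\<in>J. S j) \<union> (\<Union>i\<in>I. (`) (f i) ` U)" (is "?V = _")
  proof -
    have "(\<Union>i\<in>I. (`) (f i) ` U) = (\<Union>j\<in>J. (`) (f (\<rho> j)) ` set_mset (B (\<tau> j)))"
    proof (intro equalityI subsetI)
      fix b assume "b \<in> (\<Union>i\<in>I. (`) (f i) ` U)"
      then obtain i q c where c: "i \<in> I" "q \<in> Q" "c \<in># B q" "b = f i ` c" unfolding U_def by blast
      with tauU[OF c(1,2)] show "b \<in> (\<Union>j\<in>J. (`) (f (\<rho> j)) ` set_mset (B (\<tau> j)))" by blast
    qed (use BU rho in blast)
    then show ?thesis using setB' by auto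
  qed
  have V: "(\<exists>j\<in>J. b \<in> S j) \<or> (\<exists>i\<in>I. \<exists>c\<in>U. b = f i ` c)" if "b \<in> ?V" for b
    using that unfolding union by auto
  have VS: "b \<in> ?V" if "j \<in> J" "b \<in> S j" for j b
    using that unfolding union by auto
  have VU: "f i ` c \<in> ?V" if "i \<in> I" "c \<in> U" for i c
    using that unfolding union by auto
  have size: "b \<subseteq> X" "card b \<in> K" if b: "b \<in> (\<Union>j\<in>J. set_mset (B' j))" for b
  proof -
    have "b \<subseteq> X \<and> card b \<in> K"
    proof (cases "b \<in> (\<Union>j\<in>J. S j)")
      case True then show ?thesis using S K(1) by auto
    next
      case False
      then obtain i c where c: "i \<in> I" "c \<in> U" "b = f i ` c" using V[OF b] by auto
      have "b \<subseteq> X"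
        unfolding c(3) by (rule order_trans[OF fsub[OF c(1) Ucard(2)[OF c(2)]] L(1)[OF c(1)]])
      moreover have "card b \<in> K"
        unfolding c(3) fcard[OF c(1) Ucard(2)[OF c(2)]] by (rule Ucard(3)[OF c(2)])
      ultimately show ?thesis ..
    qed
    then show "b \<subseteq> X" "card b \<in> K" by auto
  qed
  have S2': "is_S2 2 K (card X) X (B' j)" if j: "j \<in> J" for j
  proof -
    let ?i = "\<rho> j"
    have i: "?i \<in> I" using rho j .
    have "size (filter_mset (\<lambda>b. P \<subseteq> b) (B' j)) = 2" if P: "P \<subseteq> X" "card P = 2" for P
    proof -
      have eq: "size (filter_mset (\<lambda>b. P \<subseteq> b) (B' j)) =
          card {b \<in> S j. P \<subseteq> b} + size (filter_mset (\<lambda>b. P \<subseteq> f ?i ` b) (B (\<tau> j)))"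
        using finS[OF j] by (simp add: B'_def filter_mset_image_mset)
      show ?thesis
      proof (cases "P \<subseteq> L ?i")
        case True
        define P' where "P' = {y \<in> Y. f ?i y \<in> P}"
        have P': "P' \<subseteq> Y" "f ?i ` P' = P" using True fim[OF i] unfolding P'_def by auto
        have "card P' = 2" using fcard[OF i P'(1)] P' P by simp
        moreover have "filter_mset (\<lambda>b. P \<subseteq> f ?i ` b) (B (\<tau> j)) = filter_mset (\<lambda>b. P' \<subseteq> b) (B (\<tau> j))"
        proof (rule filter_mset_cong[OF refl])
          fix b assume "b \<in># B (\<tau> j)"
          then have "b \<subseteq> Y" using BK tauQ j by blast
          then show "P \<subseteq> f ?i ` b \<longleftrightarrow> P' \<subseteq> b"
            using fss[OF i P'(1)] P'(2) by auto
        qed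
        ultimately show ?thesis using eq pairs[OF j P] True BP[OF tauQ[OF j] P'(1)] by simp
      next
        case False
        have "filter_mset (\<lambda>b. P \<subseteq> f ?i ` b) (B (\<tau> j)) = {#}"
        proof -
          have "\<not> P \<subseteq> f ?i ` b" if "b \<in># B (\<tau> j)" for b
            using fsub[OF i BK(1)[OF that tauQ[OF j]]] False by blast
          then show ?thesis by (auto simp: multiset_eq_iff count_eq_zero_iff)
        qed
        then show ?thesis using eq pairs[OF j P] False by simp
      qed
    qed
    moreover have "0 \<notin> K" using K by fastforce
    ultimately show ?thesis unfolding is_S2_def using fin j size by blast
  qed
  have S3': "is_S3 K (card X) X (\<Union>j\<in>J. set_mset (B' j))"
  proof -
    have ex1: "\<exists>!b. b \<in> ?V \<and> t \<subseteq> b" if t: "t \<subseteq> X" "card t = 3" for t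
    proof (cases "\<exists>i\<in>I. t \<subseteq> L i")
      case True
      then obtain i where i: "i \<in> I" "t \<subseteq> L i" by blast
      define t' where "t' = {y \<in> Y. f i y \<in> t}"
      have t': "t' \<subseteq> Y" "f i ` t' = t" using i fim[OF i(1)] unfolding t'_def by auto
      have "card t' = 3" using fcard[OF i(1) t'(1)] t' t by simp
      then obtain b where b: "b \<in> U" "t' \<subseteq> b" and bu: "\<And>c. c \<in> U \<Longrightarrow> t' \<subseteq> c \<Longrightarrow> c = b"
        using UT[OF t'(1)] by blast
      show ?thesis
      proof
        show "f i ` b \<in> ?V \<and> t \<subseteq> f i ` b" using VU[OF i(1) b(1)] b(2) t'(2) by auto
      next
        fix c assume c: "c \<in> ?V \<and> t \<subseteq> c"
        have "c \<notin> S j" if "j \<in> J" for j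
        proof
          assume "c \<in> S j"
          then have "card c = 3" "\<not> c \<subseteq> L i" using S that i by blast+
          moreover have "finite c" using \<open>card c = 3\<close> by (simp add: card_ge_0_finite)
          ultimately have "t = c" using c t card_subset_eq[of c t] by auto
          then show False using i \<open>\<not> c \<subseteq> L i\<close> by simp
        qed
        then obtain i' c' where c': "i' \<in> I" "c' \<in> U" "c = f i' ` c'" using V[of c] c by auto
        have "c \<subseteq> L i'" unfolding c'(3) by (rule fsub[OF c'(1) Ucard(2)[OF c'(2)]])
        then have "i' = i" using three_le_card_unique[OF LL[OF i(1) c'(1)] finL[OF i(1)] i(2), of] c t by auto
        then have "t' \<subseteq> c'" using c c' t' fss[OF i(1) t'(1) Ucard(2)[OF c'(2)]]
          by auto
        then show "c = f i ` b" using bu c' \<open>i' = i\<close> by simp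
      qed
    next
      case False
      then obtain j where j: "j \<in> J" "t \<in> S j" using triples[OF t] by blast
      show ?thesis
      proof
        show "t \<in> ?V \<and> t \<subseteq> t" using VS[OF j] by simp
      next
        fix c assume c: "c \<in> ?V \<and> t \<subseteq> c"
        have "c \<noteq> f i ` c'" if "i \<in> I" "c' \<in> U" for i c'
          using fsub[OF that(1) Ucard(2)[OF that(2)]] False c that(1) by (metis order_trans)
        then obtain j' where "j' \<in> J" "c \<in> S j'" using V[of c] c by auto
        then have "card c = 3" using S by blast
        moreover have "finite c" using \<open>card c = 3\<close> by (simp add: card_ge_0_finite)
        ultimately show "c = t" using c t card_subset_eq[of c t] by auto
      qed
    qed
    have 0: "0 \<notin> K" using K by fastforce
    have "\<forall>b\<in>?V. b \<subseteq> X \<and> card b \<in> K" using size by (intro ballI conjI)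
    moreover have "\<forall>t. t \<subseteq> X \<and> card t = 3 \<longrightarrow> (\<exists>!b. b \<in> ?V \<and> t \<subseteq> b)"
      using ex1 by (intro allI impI) (elim conjE)
    ultimately show ?thesis using 0 fin(1) by (simp only: is_S3_def simp_thms)
  qed
  have cnt: "count (\<Sum>j\<in>J. B' j) b = card {j \<in> J. b \<in> S j} +
      (\<Sum>j\<in>J. count (image_mset ((`) (f (\<rho> j))) (B (\<tau> j))) b)" for b
  proof -
    have "count (\<Sum>j\<in>J. B' j) b = (\<Sum>j\<in>J. count (mset_set (S j)) b +
        count (image_mset ((`) (f (\<rho> j))) (B (\<tau> j))) b)"
      by (simp add: count_sum B'_def)
    also have "\<dots> = (\<Sum>j\<in>J. (if b \<in> S j then 1 else 0)) +
        (\<Sum>j\<in>J. count (image_mset ((`) (f (\<rho> j))) (B (\<tau> j))) b)"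
      unfolding sum.distrib by (intro arg_cong2[where f="(+)"] sum.cong refl) (auto simp: count_mset_set' finS)
    also have "(\<Sum>j\<in>J. (if b \<in> S j then 1 else 0)) = card {j \<in> J. b \<in> S j}"
      using fin by (simp add: sum.If_cases Int_def)
    finally show ?thesis .
  qed
  have Bim: "b \<subseteq> L (\<rho> j)" if "j \<in> J" "b \<in># image_mset ((`) (f (\<rho> j))) (B (\<tau> j))" for b j
    using that fsub[OF rho[OF that(1)]] BK(1)[OF _ tauQ[OF that(1)]] by fastforce
  have cim: "count (image_mset ((`) (f (\<rho> j))) (B (\<tau> j))) (f (\<rho> j) ` c) = count (B (\<tau> j)) c"
    if "j \<in> J" "c \<in> U" for j c
  proof (rule count_image_mset_inj_on, rule inj_on_subset[OF injP[OF rho[OF that(1)]]])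
    show "insert c (set_mset (B (\<tau> j))) \<subseteq> Pow Y" using that Ucard(2) BU by blast
  qed
  have mult: "count (\<Sum>j\<in>J. B' j) b + 2 = card b" if b: "b \<in> ?V" for b
  proof (cases "b \<in> (\<Union>j\<in>J. S j)")
    case True
    then obtain j where j: "j \<in> J" "b \<in> S j" by blast
    have Sb: "b \<subseteq> X" "card b = 3" "\<And>i. i \<in> I \<Longrightarrow> \<not> b \<subseteq> L i" using S[OF j] by auto
    have "{k \<in> J. b \<in> S k} = {j}" using triples[OF Sb] j by blast
    moreover have "count (image_mset ((`) (f (\<rho> k))) (B (\<tau> k))) b = 0" if "k \<in> J" for k
      using Bim[OF that] Sb(3)[OF rho[OF that]] by (meson not_in_iff)
    ultimately show ?thesis using cnt Sb by simp
  next
    case False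
    then obtain i c where c: "i \<in> I" "c \<in> U" "b = f i ` c" using V[OF b] by auto
    have bc: "card b = card c" "b \<subseteq> L i"
      unfolding c(3) by (rule fcard[OF c(1) Ucard(2)[OF c(2)]], rule fsub[OF c(1) Ucard(2)[OF c(2)]])
    have 0: "count (image_mset ((`) (f (\<rho> j))) (B (\<tau> j))) b = 0" if "j \<in> J" "\<rho> j \<noteq> i" for j
      using Bim[OF that(1), of b] three_le_card_unique[OF LL[OF c(1) rho[OF that(1)]] finL[OF c(1)] bc(2)] that
        Ucard(1)[OF c(2)] bc by (metis not_in_iff)
    have "(\<Sum>j\<in>J. count (image_mset ((`) (f (\<rho> j))) (B (\<tau> j))) b) =
        (\<Sum>j\<in>{j\<in>J. \<rho> j = i}. count (B (\<tau> j)) c)"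
      using fin(2) 0 cim[OF _ c(2)] c(3) by (intro sum.mono_neutral_cong_right) auto
    also have "\<dots> = (\<Sum>q\<in>Q. count (B q) c)"
      by (rule sum.reindex_bij_betw[OF tau[OF c(1)]])
    also have "\<dots> = count (\<Sum>q\<in>Q. B q) c" by (simp add: count_sum)
    finally have "(\<Sum>j\<in>J. count (image_mset ((`) (f (\<rho> j))) (B (\<tau> j))) b) = count (\<Sum>q\<in>Q. B q) c" .
    moreover have "card {j \<in> J. b \<in> S j} = 0" using False by (intro card_eq_0_iff[THEN iffD2] disjI1) blast
    ultimately show ?thesis using cnt[of b] Ucount[OF c(2)] bc(1) by simp
  qed
  have "count (B' j) b = 2" if j: "j \<in> J" and b: "b \<in># B' j" "4 \<le> card b" for j b
  proof -
    have ns: "b \<notin> S j" using S[OF j, of b] b by auto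
    then obtain c where c: "c \<in># B (\<tau> j)" "b = f (\<rho> j) ` c" using b setB'[OF j] by auto
    have "card b = card c" using c fcard[OF rho[OF j]] BU[OF j] Ucard by metis
    then show ?thesis using cim[OF j BU[OF j c(1)]] ns c star[OF tauQ[OF j] c(1)] b finS[OF j]
      by (simp add: B'_def)
  qed
  then have "is_LS_star 2 K (card X) X J B'"
    unfolding is_LS_star_def is_LS_def using fin S2' S3' mult by blast
  then show ?thesis by blast
qed

definition LS_exists :: "nat set \<Rightarrow> nat \<Rightarrow> bool" where
  "LS_exists K v \<longleftrightarrow>
     (\<exists>B :: nat \<Rightarrow> nat set multiset. is_LS_star 2 K v {..<v} {..<(v - 2) div 2} B)"

lemma LS_existsI:
  assumes "is_LS_star 2 K (card X) X J B" "card J = (card X - 2) div 2"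
    and "3 \<in> K" "\<And>k. k \<in> K \<Longrightarrow> 3 \<le> k"
  shows "LS_exists K (card X)"
proof -
  have "finite J" "finite X" using assms by (auto simp: is_LS_star_def is_LS_def is_S3_def)
  then obtain \<tau> where \<tau>: "bij_betw \<tau> {..<(card X - 2) div 2} J"
    using assms(2) finite_same_card_bij[of "{..<(card X - 2) div 2}" J] by auto
  have "\<exists>B'. is_LS_star 2 K (card {..<card X}) {..<card X} {..<(card X - 2) div 2} B'"
    by (rule is_LS_star_fill[OF assms(1,3,4), where I="{()}" and L="\<lambda>_. {..<card X}"
          and S="\<lambda>_. {}" and \<rho>="\<lambda>_. ()" and \<tau>=\<tau>])
      (use \<tau> in \<open>auto simp: lessThan_def\<close>)
  then show ?thesis unfolding LS_exists_def by auto
qed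

lemma LS_exists_two:
  assumes "\<And>k. k \<in> K \<Longrightarrow> 3 \<le> (k::nat)"
  shows "LS_exists K 2"
proof -
  have "\<not> t \<subseteq> {..<2::nat}" if "card t = 3" for t
    using card_mono[of "{..<2::nat}" t] that by auto
  then show ?thesis
    unfolding LS_exists_def is_LS_star_def is_LS_def is_S3_def using assms by fastforce
qed

lemma LS_exists_one_block:
  assumes K: "\<And>k. k \<in> K \<Longrightarrow> 3 \<le> k" and v: "v \<in> K" "even v"
  shows "LS_exists K v"
proof -
  define B where "B = (\<lambda>r::nat. {#{..<v}, {..<v}#})"
  let ?R = "{..<(v - 2) div 2}"
  have v4: "4 \<le> v" using K[OF v(1)] v(2) by (cases "v = 3") auto
  have 0: "0 \<notin> K" using K by fastforce
  have "0 \<in> ?R" using v4 by auto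
  then have U: "(\<Union>r\<in>?R. set_mset (B r)) = {{..<v}}" by (auto simp: B_def)
  have "count (\<Sum>r\<in>?R. B r) {..<v} + 2 = v"
    proof -
    have "2 * ((v - 2) div 2) = v - 2" using v(2) by simp
    then show ?thesis using v4 by (simp add: count_sum B_def)
  qed
  moreover have "is_S2 2 K v {..<v} (B r)" for r
    using 0 v by (auto simp: is_S2_def B_def)
  moreover have "is_S3 K v {..<v} {{..<v}}"
    using 0 v by (auto simp: is_S3_def)
  ultimately have "is_LS_star 2 K v {..<v} ?R B"
    unfolding is_LS_star_def is_LS_def U using v by (auto simp: B_def)
  then show ?thesis unfolding LS_exists_def by blast
qed

section \<open>Triple systems from ternary relations\<close>

definition triples_of :: "('a \<Rightarrow> 'a \<Rightarrow> 'a \<Rightarrow> bool) \<Rightarrow> 'a set set" where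
  "triples_of R = {{u, v, w} | u v w. R u v w}"

locale triple_relation =
  fixes R :: "'a \<Rightarrow> 'a \<Rightarrow> 'a \<Rightarrow> bool"
  assumes swap12: "R u v w \<Longrightarrow> R v u w" and swap23: "R u v w \<Longrightarrow> R u w v"
    and irrefl12: "R u v w \<Longrightarrow> u \<noteq> v"
begin

lemma distinct3: "R u v w \<Longrightarrow> u \<noteq> v \<and> u \<noteq> w \<and> v \<noteq> w"
  using irrefl12 swap12 swap23 by blast

lemma mem_triples_of: "{u, v, w} \<in> triples_of R \<longleftrightarrow> R u v w"
proof
  assume "{u, v, w} \<in> triples_of R"
  then obtain a b c where abc: "{u, v, w} = {a, b, c}" "R a b c" by (auto simp: triples_of_def)
  have d: "a \<noteq> b" "a \<noteq> c" "b \<noteq> c" using distinct3[OF abc(2)] by auto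
  have "u = a \<and> v = b \<and> w = c \<or> u = a \<and> v = c \<and> w = b \<or> u = b \<and> v = a \<and> w = c \<or>
        u = b \<and> v = c \<and> w = a \<or> u = c \<and> v = a \<and> w = b \<or> u = c \<and> v = b \<and> w = a"
    using abc(1) d unfolding set_eq_iff insert_iff empty_iff by metis
  moreover have "R a c b" "R b a c" "R b c a" "R c a b" "R c b a"
    using abc(2) swap12 swap23 by blast+
  ultimately show "R u v w" using abc(2) by blast
qed (auto simp: triples_of_def)

lemma card_triples_of: "b \<in> triples_of R \<Longrightarrow> card b = 3"
  by (auto simp: triples_of_def dest!: distinct3)

lemma card_triples_of_through:
  assumes "u \<noteq> v"
  shows "card {b \<in> triples_of R. {u, v} \<subseteq> b} = card {w. R u v w}"
proof -
  have "{b \<in> triples_of R. {u, v} \<subseteq> b} = (\<lambda>w. {u, v, w}) ` {w. R u v w}"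
  proof (intro equalityI subsetI)
    fix b assume "b \<in> {b \<in> triples_of R. {u, v} \<subseteq> b}"
    then have b: "b \<in> triples_of R" "{u, v} \<subseteq> b" by auto
    have "card (b - {u, v}) = 1"
      using card_triples_of[OF b(1)] b(2) assms by (simp add: card_Diff_subset)
    then obtain w where "b - {u, v} = {w}" by (auto simp: card_1_singleton_iff)
    then have "b = {u, v, w}" using b(2) by auto
    then show "b \<in> (\<lambda>w. {u, v, w}) ` {w. R u v w}" using b mem_triples_of by auto
  qed (auto simp: mem_triples_of)
  moreover have "inj_on (\<lambda>w. {u, v, w}) {w. R u v w}"
  proof (rule inj_onI, clarsimp)
    fix x y assume "R u v x" "R u v y" "{u, v, x} = {u, v, y}"
    then have "x \<in> {u, v, y}" "u \<noteq> x" "v \<noteq> x" using distinct3 by blast+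
    then show "x = y" by simp
  qed
  ultimately show ?thesis by (simp add: card_image)
qed

end

section \<open>Inflating tagged frames\<close>

lemma ex1_add_mod:
  fixes m c k :: nat
  assumes "c < m"
  shows "\<exists>!z. z < m \<and> (k + z) mod m = c"
proof (rule ex_ex1I)
  have "(k + (c + (m - 1) * k) mod m) mod m = (k + (c + (m - 1) * k)) mod m"
    by (simp add: mod_add_right_eq)
  also have "k + (c + (m - 1) * k) = c + m * k" using assms by (cases m) auto
  finally have "(k + (c + (m - 1) * k) mod m) mod m = c" using assms by simp
  then show "\<exists>z. z < m \<and> (k + z) mod m = c" using assms by (intro exI[of _ "(c + (m - 1) * k) mod m"]) auto
next
  fix y z assume "y < m \<and> (k + y) mod m = c" "z < m \<and> (k + z) mod m = c"
  then have "[k + y = k + z] (mod m)" by (simp add: cong_def)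
  then have "[y = z] (mod m)" by (simp add: cong_add_lcancel_nat)
  then show "y = z" using \<open>y < m \<and> _\<close> \<open>z < m \<and> _\<close> by (simp add: cong_def)
qed

lemma card_half_sum:
  fixes h k x :: nat
  assumes "0 < h"
  shows "card {y. y < 2 * h \<and> ((x + y + 1) div 2) mod h = k mod h} = 2"
proof -
  let ?c = "k mod h"
  have c: "2 * ?c < 2 * h" "2 * ?c + 1 < 2 * h" using mod_less_divisor[OF assms, of k] by linarith+
  obtain y where y: "y < 2 * h" "(x + 1 + y) mod (2 * h) = 2 * ?c"
    and yu: "\<And>z. z < 2 * h \<Longrightarrow> (x + 1 + z) mod (2 * h) = 2 * ?c \<Longrightarrow> z = y"
    using ex1_add_mod[OF c(1)] by blast
  obtain y' where y': "y' < 2 * h" "(x + 1 + y') mod (2 * h) = 2 * ?c + 1"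
    and yu': "\<And>z. z < 2 * h \<Longrightarrow> (x + 1 + z) mod (2 * h) = 2 * ?c + 1 \<Longrightarrow> z = y'"
    using ex1_add_mod[OF c(2)] by blast
  have iff: "((x + z + 1) div 2) mod h = ?c \<longleftrightarrow>
      (x + 1 + z) mod (2 * h) = 2 * ?c \<or> (x + 1 + z) mod (2 * h) = 2 * ?c + 1" for z
    using mod_mult2_eq[of "x + 1 + z" 2 h] by (auto simp: ac_simps)
  have "{z. z < 2 * h \<and> ((x + z + 1) div 2) mod h = ?c} = {y, y'}"
    unfolding iff using y yu y' yu' by blast
  moreover have "y \<noteq> y'" using y y' by auto
  ultimately show ?thesis by simp
qed

lemma half_turn:
  fixes h k x :: nat
  assumes "x < 2 * h"
  shows "x mod h = k mod h \<longleftrightarrow> (\<exists>b. x = (k + (if b then h else 0)) mod (2 * h))"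
    and "x = (k + (if b then h else 0)) mod (2 * h) \<Longrightarrow>
         x = (k + (if b' then h else 0)) mod (2 * h) \<Longrightarrow> b = b'"
proof -
  have h: "0 < h" using assms by auto
  have eq: "k mod (2 * h) = k mod h + (if even (k div h) then 0 else h)"
    using mod_mult2_eq[of k h 2] by (simp add: mult.commute[of 2] mod2_eq_if)
  have eq': "(k + h) mod (2 * h) = k mod h + (if even (k div h) then h else 0)"
    using mod_mult2_eq[of "k + h" h 2] h by (simp add: mult.commute[of 2] mod2_eq_if div_add_self2)
  have km: "k mod h < h" using h by simp
  have "x mod h = (if x < h then x else x - h)" using assms by (simp add: mod_if)
  then have iff: "x mod h = k mod h \<longleftrightarrow> x = k mod h \<or> x = k mod h + h" using km by (cases "x < h") auto
  show "x mod h = k mod h \<longleftrightarrow> (\<exists>b. x = (k + (if b then h else 0)) mod (2 * h))"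
    unfolding ex_bool_eq if_True if_False add_0_right eq eq' iff by (cases "even (k div h)") auto
  show "b = b'" if "x = (k + (if b then h else 0)) mod (2 * h)"
    "x = (k + (if b' then h else 0)) mod (2 * h)"
    using that eq eq' h by (cases b; cases b'; cases "even (k div h)") simp_all
qed

datatype point = Ideal bool | Pt nat nat

text \<open>Points \<open>0, \<dots>, N - 1\<close> are grouped by their residue mod \<open>n\<close>. System \<open>\<sigma>\<close> has the group of \<open>\<sigma>\<close>
  as a hole; \<open>T \<sigma> p q r e\<close> says that it contains the triple \<open>{p, q, r}\<close> with parity tag \<open>e\<close>, and
  \<open>A \<sigma> p q\<close> that it contains the arc from \<open>p\<close> to \<open>q\<close>. A pair outside the hole is covered by two tagged
  triples or by one arc.\<close>

locale tagged_frame =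
  fixes N n g :: nat
    and T :: "nat \<Rightarrow> nat \<Rightarrow> nat \<Rightarrow> nat \<Rightarrow> nat \<Rightarrow> bool"
    and A :: "nat \<Rightarrow> nat \<Rightarrow> nat \<Rightarrow> bool"
  assumes n_pos: "0 < n" and N_eq: "N = n * g"
    and T_dom: "\<sigma> < N \<Longrightarrow> T \<sigma> p q r e \<Longrightarrow> p < N \<and> q < N \<and> r < N \<and> p \<noteq> q \<and> e < 2"
    and T_swap12: "\<sigma> < N \<Longrightarrow> T \<sigma> p q r e \<Longrightarrow> T \<sigma> q p r e"
    and T_swap23: "\<sigma> < N \<Longrightarrow> T \<sigma> p q r e \<Longrightarrow> T \<sigma> p r q e"
    and T_group: "\<sigma> < N \<Longrightarrow> T \<sigma> p q r e \<Longrightarrow> p mod n = q mod n \<Longrightarrow> p mod n \<noteq> r mod n"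
    and T_hole: "\<sigma> < N \<Longrightarrow> T \<sigma> p q r e \<Longrightarrow> p mod n = \<sigma> mod n \<Longrightarrow> q mod n \<noteq> \<sigma> mod n"
    and A_dom: "\<sigma> < N \<Longrightarrow> A \<sigma> p q \<Longrightarrow> p < N \<and> q < N \<and> p mod n \<noteq> q mod n \<and>
                  p mod n \<noteq> \<sigma> mod n \<and> q mod n \<noteq> \<sigma> mod n"
    and A_antisym: "\<sigma> < N \<Longrightarrow> A \<sigma> p q \<Longrightarrow> \<not> A \<sigma> q p"
    and A_T: "\<sigma> < N \<Longrightarrow> A \<sigma> p q \<Longrightarrow> \<not> T \<sigma> p q r e"
    and cover: "\<sigma> < N \<Longrightarrow> p < N \<Longrightarrow> q < N \<Longrightarrow> p \<noteq> q \<Longrightarrow>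
        p mod n \<noteq> \<sigma> mod n \<or> q mod n \<noteq> \<sigma> mod n \<Longrightarrow> \<not> A \<sigma> p q \<Longrightarrow> \<not> A \<sigma> q p \<Longrightarrow>
        card {(r, e). T \<sigma> p q r e} = 2"
    and A_out: "\<sigma> < N \<Longrightarrow> p < N \<Longrightarrow> p mod n \<noteq> \<sigma> mod n \<Longrightarrow> \<exists>!q. A \<sigma> p q"
    and A_in: "\<sigma> < N \<Longrightarrow> p < N \<Longrightarrow> p mod n \<noteq> \<sigma> mod n \<Longrightarrow> \<exists>!q. A \<sigma> q p"
    and T_once: "p < N \<Longrightarrow> q < N \<Longrightarrow> r < N \<Longrightarrow> p \<noteq> q \<Longrightarrow> p \<noteq> r \<Longrightarrow> q \<noteq> r \<Longrightarrow>
        \<not> (p mod n = q mod n \<and> p mod n = r mod n) \<Longrightarrow> e < 2 \<Longrightarrow> \<exists>!\<sigma>. \<sigma> < N \<and> T \<sigma> p q r e"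
    and A_once: "p < N \<Longrightarrow> q < N \<Longrightarrow> p mod n \<noteq> q mod n \<Longrightarrow> \<exists>!\<sigma>. \<sigma> < N \<and> A \<sigma> p q"
begin

definition ord_bit :: "nat \<Rightarrow> nat \<Rightarrow> nat" where
  "ord_bit p q = (if p < q then 0 else 1)"

text \<open>For fixed \<open>q, z\<close> the pairs \<open>{x, y}\<close> form the zigzag Hamiltonian path of the fibre \<open>\<int>\<close>/2h over \<open>p\<close>
  (two consecutive values of \<open>x + y\<close> mod 2h); \<open>tail3\<close> joins the ends of the path, which are the
  degenerate solutions \<open>x = y\<close>, to the two ideal points. The shift \<open>ord_bit\<close> makes the tails of the arcs \<open>(p, q)\<close> and \<open>(q, p)\<close>
  complementary.\<close>

definition fold3 :: "nat \<Rightarrow> nat \<Rightarrow> nat \<Rightarrow> nat \<Rightarrow> nat \<Rightarrow> nat \<Rightarrow> nat \<Rightarrow> nat \<Rightarrow> bool" where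
  "fold3 h \<sigma> s p q x y z \<longleftrightarrow>
     A \<sigma> p q \<and> x \<noteq> y \<and> ((x + y + 1) div 2) mod h = (z + s + ord_bit p q) mod h"

definition tail3 :: "nat \<Rightarrow> nat \<Rightarrow> nat \<Rightarrow> bool \<Rightarrow> nat \<Rightarrow> nat \<Rightarrow> nat \<Rightarrow> nat \<Rightarrow> bool" where
  "tail3 h \<sigma> s b p q x z \<longleftrightarrow>
     A \<sigma> p q \<and> x = (z + s + ord_bit p q + (if b then h else 0)) mod (2 * h)"

fun block_rel :: "nat \<Rightarrow> nat \<Rightarrow> nat \<Rightarrow> point \<Rightarrow> point \<Rightarrow> point \<Rightarrow> bool" where
  "block_rel h \<sigma> s (Pt p x) (Pt q y) (Pt r z) \<longleftrightarrow> x < 2 * h \<and> y < 2 * h \<and> z < 2 * h \<and>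
     ((\<exists>e. T \<sigma> p q r e \<and> (x + y + z) mod (2 * h) = 2 * s + e) \<or>
      p = q \<and> fold3 h \<sigma> s p r x y z \<or> p = r \<and> fold3 h \<sigma> s p q x z y \<or> q = r \<and> fold3 h \<sigma> s q p y z x)"
| "block_rel h \<sigma> s (Ideal b) (Pt p x) (Pt q y) \<longleftrightarrow> x < 2 * h \<and> y < 2 * h \<and>
     (tail3 h \<sigma> s b p q x y \<or> tail3 h \<sigma> s b q p y x)"
| "block_rel h \<sigma> s (Pt p x) (Ideal b) (Pt q y) \<longleftrightarrow> x < 2 * h \<and> y < 2 * h \<and>
     (tail3 h \<sigma> s b p q x y \<or> tail3 h \<sigma> s b q p y x)"
| "block_rel h \<sigma> s (Pt p x) (Pt q y) (Ideal b) \<longleftrightarrow> x < 2 * h \<and> y < 2 * h \<and>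
     (tail3 h \<sigma> s b p q x y \<or> tail3 h \<sigma> s b q p y x)"
| "block_rel h \<sigma> s (Ideal _) (Ideal _) _ \<longleftrightarrow> False"
| "block_rel h \<sigma> s (Ideal _) _ (Ideal _) \<longleftrightarrow> False"
| "block_rel h \<sigma> s _ (Ideal _) (Ideal _) \<longleftrightarrow> False"

lemma fold3_swap: "fold3 h \<sigma> s p q x y z \<longleftrightarrow> fold3 h \<sigma> s p q y x z"
  by (auto simp: fold3_def add.commute[of x])

lemma T_distinct: "\<sigma> < N \<Longrightarrow> T \<sigma> p q r e \<Longrightarrow> p \<noteq> q \<and> p \<noteq> r \<and> q \<noteq> r"
  using T_dom T_swap12 T_swap23 by blast

lemma A_irrefl: "\<sigma> < N \<Longrightarrow> \<not> A \<sigma> p p"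
  using A_dom by blast

lemma block_rel_swap12:
  assumes "\<sigma> < N" "block_rel h \<sigma> s u v w"
  shows "block_rel h \<sigma> s v u w"
  using assms(2) T_swap12[OF assms(1)]
  by (cases u; cases v; cases w) (auto simp: ac_simps fold3_swap)

lemma block_rel_swap23:
  assumes "\<sigma> < N" "block_rel h \<sigma> s u v w"
  shows "block_rel h \<sigma> s u w v"
  using assms(2) T_swap23[OF assms(1)]
  by (cases u; cases v; cases w) (auto simp: ac_simps fold3_swap)

lemma block_rel_irrefl12:
  assumes "\<sigma> < N" "block_rel h \<sigma> s u v w"
  shows "u \<noteq> v"
  using assms(2) T_distinct[OF assms(1)] A_irrefl[OF assms(1)]
  by (cases u; cases v; cases w) (auto simp: fold3_def tail3_def)

lemma triple_relation_block_rel: "\<sigma> < N \<Longrightarrow> triple_relation (block_rel h \<sigma> s)"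
  by unfold_locales (blast intro: block_rel_swap12 block_rel_swap23 dest: block_rel_irrefl12)+

lemma block_rel_transversal:
  assumes "p \<noteq> q" "p \<noteq> r" "q \<noteq> r"
  shows "block_rel h \<sigma> s (Pt p x) (Pt q y) (Pt r z) \<longleftrightarrow> x < 2 * h \<and> y < 2 * h \<and> z < 2 * h \<and>
     (\<exists>e. T \<sigma> p q r e \<and> (x + y + z) mod (2 * h) = 2 * s + e)"
  using assms by auto

lemma block_rel_fold:
  assumes "\<sigma> < N" "p \<noteq> q"
  shows "block_rel h \<sigma> s (Pt p x) (Pt p y) (Pt q z) \<longleftrightarrow>
    x < 2 * h \<and> y < 2 * h \<and> z < 2 * h \<and> fold3 h \<sigma> s p q x y z"
  using assms T_distinct[OF assms(1)] by auto

lemma completions_cover: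
  assumes \<sigma>: "\<sigma> < N" and s: "s < h" and pq: "p < N" "q < N" "p \<noteq> q"
    and hole: "p mod n \<noteq> \<sigma> mod n \<or> q mod n \<noteq> \<sigma> mod n"
    and nA: "\<not> A \<sigma> p q" "\<not> A \<sigma> q p" and x: "x < 2 * h" and y: "y < 2 * h"
  shows "card {w. block_rel h \<sigma> s (Pt p x) (Pt q y) w} = 2"
proof -
  have "\<exists>!z. z < 2 * h \<and> (x + y + z) mod (2 * h) = 2 * s + e" if "e < 2" for e
    using that s by (intro ex1_add_mod) linarith
  then obtain z where z: "\<And>e. e < 2 \<Longrightarrow> z e < 2 * h \<and> (x + y + z e) mod (2 * h) = 2 * s + e"
    and zu: "\<And>e t. e < 2 \<Longrightarrow> t < 2 * h \<Longrightarrow> (x + y + t) mod (2 * h) = 2 * s + e \<Longrightarrow> t = z e"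
    by metis
  let ?C = "{(r, e). T \<sigma> p q r e}"
  have "{w. block_rel h \<sigma> s (Pt p x) (Pt q y) w} = (\<lambda>(r, e). Pt r (z e)) ` ?C"
  proof (intro equalityI subsetI)
    fix w assume w: "w \<in> {w. block_rel h \<sigma> s (Pt p x) (Pt q y) w}"
    show "w \<in> (\<lambda>(r, e). Pt r (z e)) ` ?C"
    proof (cases w)
      case (Ideal b) then show ?thesis using w nA by (auto simp: tail3_def)
    next
      case (Pt r t)
      have "t < 2 * h \<and> (\<exists>e. T \<sigma> p q r e \<and> (x + y + t) mod (2 * h) = 2 * s + e)"
        using w nA pq(3) unfolding Pt by (simp add: fold3_def)
      then obtain e where e: "T \<sigma> p q r e" "(x + y + t) mod (2 * h) = 2 * s + e" "t < 2 * h" by blast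
      then have "t = z e" using zu T_dom[OF \<sigma>] by blast
      then show ?thesis using e(1) Pt by force
    qed
  next
    fix w assume "w \<in> (\<lambda>(r, e). Pt r (z e)) ` ?C"
    then obtain r e where re: "T \<sigma> p q r e" "w = Pt r (z e)" by auto
    then show "w \<in> {w. block_rel h \<sigma> s (Pt p x) (Pt q y) w}" using z[of e] T_dom[OF \<sigma> re(1)] x y by auto
  qed
  moreover have "inj_on (\<lambda>(r, e). Pt r (z e)) ?C"
  proof (rule inj_onI)
    fix c c' assume c: "c \<in> ?C" "c' \<in> ?C" and eq: "(case c of (r, e) \<Rightarrow> Pt r (z e)) = (case c' of (r, e) \<Rightarrow> Pt r (z e))"
    have "T \<sigma> p q (fst c) (snd c)" "T \<sigma> p q (fst c') (snd c')" using c by (simp_all add: case_prod_beta)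
    then have "snd c < 2" "snd c' < 2" using T_dom[OF \<sigma>] by blast+
    then have "(x + y + z (snd c)) mod (2 * h) = 2 * s + snd c" "(x + y + z (snd c')) mod (2 * h) = 2 * s + snd c'"
      using z by blast+
    moreover have "fst c = fst c'" "z (snd c) = z (snd c')" using eq by (simp_all add: case_prod_beta)
    ultimately show "c = c'" by (metis add_left_cancel prod.collapse)
  qed
  ultimately show ?thesis using cover[OF \<sigma> pq hole nA] by (simp add: card_image)
qed

lemma completions_arc:
  assumes \<sigma>: "\<sigma> < N" and h: "0 < h" and A: "A \<sigma> p q" and x: "x < 2 * h" and z: "z < 2 * h"
  shows "card {w. block_rel h \<sigma> s (Pt p x) (Pt q z) w} = 2"
proof -
  define k where "k = z + s + ord_bit p q"
  define W where "W = {y. y < 2 * h \<and> ((x + y + 1) div 2) mod h = k mod h}"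
  define V where "V = {b. x = (k + (if b then h else 0)) mod (2 * h)}"
  have W: "card W = 2" "finite W" unfolding W_def using card_half_sum[OF h, of x k] by (auto simp: card_ge_0_finite)
  have pq: "p \<noteq> q" using A_dom[OF \<sigma> A] by auto
  have "{w. block_rel h \<sigma> s (Pt p x) (Pt q z) w} = Pt p ` (W - {x}) \<union> Ideal ` V" (is "?L = ?R")
  proof (intro equalityI subsetI)
    fix w assume w: "w \<in> ?L"
    show "w \<in> ?R"
    proof (cases w)
      case (Ideal b) then show ?thesis using w A_antisym[OF \<sigma> A] by (auto simp: tail3_def V_def k_def)
    next
      case (Pt r t) then show ?thesis
        using w pq A_antisym[OF \<sigma> A] A_T[OF \<sigma> A] by (auto simp: fold3_def W_def k_def)
    qed
  next
    fix w assume "w \<in> ?R"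
    then show "w \<in> ?L" using A pq x z by (auto simp: fold3_def W_def V_def k_def tail3_def)
  qed
  moreover have "card (Pt p ` (W - {x}) \<union> Ideal ` V) = card (W - {x}) + card V"
    using W(2) by (subst card_Un_disjoint) (auto simp: card_image inj_on_def)
  moreover have "x \<in> W \<longleftrightarrow> V \<noteq> {}"
    using half_turn(1)[OF x, of k] x by (auto simp: W_def V_def)
  moreover have "card V = (if V = {} then 0 else 1)"
  proof (cases "V = {}")
    case False
    then obtain b where "b \<in> V" by blast
    then have "V = {b}" using half_turn(2)[OF x] unfolding V_def by blast
    then show ?thesis by simp
  qed simp
  ultimately show ?thesis using W by (auto simp: card_Diff_singleton_if)
qed

lemma completions_fibre:
  assumes \<sigma>: "\<sigma> < N" and h: "0 < h" and p: "p < N" "p mod n \<noteq> \<sigma> mod n"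
    and xy: "x < 2 * h" "y < 2 * h" "x \<noteq> y"
  shows "card {w. block_rel h \<sigma> s (Pt p x) (Pt p y) w} = 2"
proof -
  obtain q where q: "A \<sigma> p q" "\<And>q'. A \<sigma> p q' \<Longrightarrow> q' = q" using A_out[OF \<sigma> p] by metis
  have pq: "p \<noteq> q" using A_dom[OF \<sigma> q(1)] by auto
  let ?c = "((x + y + 1) div 2) mod h"
  have c: "?c < h" using h by simp
  obtain z where z: "z < h" "(s + ord_bit p q + z) mod h = ?c"
    and zu: "\<And>t. t < h \<Longrightarrow> (s + ord_bit p q + t) mod h = ?c \<Longrightarrow> t = z"
    using ex1_add_mod[OF c] by blast
  have red: "(t + s + ord_bit p q) mod h = (s + ord_bit p q + t mod h) mod h" for t
    using mod_add_right_eq[of "s + ord_bit p q" t h] by (simp add: ac_simps)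
  have "{w. block_rel h \<sigma> s (Pt p x) (Pt p y) w} = {Pt q z, Pt q (z + h)}" (is "?L = ?R")
  proof (intro equalityI subsetI)
    fix w assume w: "w \<in> ?L"
    show "w \<in> ?R"
    proof (cases w)
      case (Ideal b) then show ?thesis using w A_irrefl[OF \<sigma>] by (auto simp: tail3_def)
    next
      case (Pt r t)
      then have t: "fold3 h \<sigma> s p r x y t" "t < 2 * h"
        using w T_distinct[OF \<sigma>] A_irrefl[OF \<sigma>] by (auto simp: fold3_def)
      then have "r = q" "(s + ord_bit p q + t mod h) mod h = ?c"
        using q(2) red[of t] by (auto simp: fold3_def)
      then have "t mod h = z" using zu h by simp
      then have "t = z \<or> t = z + h" using t(2) by (auto simp: mod_if split: if_splits)
      then show ?thesis using Pt \<open>r = q\<close> by auto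
    qed
  next
    fix w assume "w \<in> ?R"
    moreover have "fold3 h \<sigma> s p q x y z" "fold3 h \<sigma> s p q x y (z + h)"
      using q(1) xy(3) z red[of z] red[of "z + h"] by (simp_all add: fold3_def)
    ultimately show "w \<in> ?L" using z xy by auto
  qed
  then show ?thesis using h by simp
qed

lemma completions_Ideal:
  assumes \<sigma>: "\<sigma> < N" and h: "0 < h" and p: "p < N" "p mod n \<noteq> \<sigma> mod n" and x: "x < 2 * h"
  shows "card {w. block_rel h \<sigma> s (Ideal b) (Pt p x) w} = 2"
proof -
  obtain q where q: "A \<sigma> p q" "\<And>q'. A \<sigma> p q' \<Longrightarrow> q' = q" using A_out[OF \<sigma> p] by metis
  obtain r where r: "A \<sigma> r p" "\<And>q'. A \<sigma> q' p \<Longrightarrow> q' = r" using A_in[OF \<sigma> p] by metis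
  have qr: "q \<noteq> r" using A_antisym[OF \<sigma> q(1)] r(1) by auto
  let ?k = "\<lambda>p q. s + ord_bit p q + (if b then h else 0)"
  obtain z where z: "z < 2 * h" "(?k p q + z) mod (2 * h) = x"
    and zu: "\<And>t. t < 2 * h \<Longrightarrow> (?k p q + t) mod (2 * h) = x \<Longrightarrow> t = z"
    using ex1_add_mod[OF x] by blast
  have "{w. block_rel h \<sigma> s (Ideal b) (Pt p x) w} = {Pt q z, Pt r ((?k r p + x) mod (2 * h))}" (is "?L = ?R")
  proof (intro equalityI subsetI)
    fix w assume w: "w \<in> ?L"
    then obtain q' t where t: "w = Pt q' t" by (cases w) auto
    then show "w \<in> ?R" using w q(2) r(2) zu[of t] by (auto simp: tail3_def ac_simps)
  next
    fix w assume "w \<in> ?R"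
    then show "w \<in> ?L" using q(1) r(1) z x h by (auto simp: tail3_def ac_simps)
  qed
  then show ?thesis using qr by simp
qed

lemma ex1_T:
  assumes h: "0 < h" and pqr: "p < N" "q < N" "r < N" "p \<noteq> q" "p \<noteq> r" "q \<noteq> r"
    and grp: "\<not> (p mod n = q mod n \<and> p mod n = r mod n)" and xyz: "x < 2 * h" "y < 2 * h" "z < 2 * h"
  shows "\<exists>!j. j \<in> {..<N} \<times> {..<h} \<and> block_rel h (fst j) (snd j) (Pt p x) (Pt q y) (Pt r z)"
proof -
  let ?c = "(x + y + z) mod (2 * h)"
  have c: "?c < 2 * h" using h by simp
  have e2: "?c mod 2 < 2" by simp
  obtain \<sigma> where \<sigma>: "\<sigma> < N \<and> T \<sigma> p q r (?c mod 2)"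
    and u: "\<And>\<tau>. \<tau> < N \<and> T \<tau> p q r (?c mod 2) \<Longrightarrow> \<tau> = \<sigma>"
    using T_once[OF pqr grp e2] by (rule ex1E) blast
  show ?thesis
  proof (rule ex1I[of _ "(\<sigma>, ?c div 2)"])
    have "?c = 2 * (?c div 2) + ?c mod 2" by simp
    moreover have "?c div 2 < h" using c by linarith
    ultimately show "(\<sigma>, ?c div 2) \<in> {..<N} \<times> {..<h} \<and>
        block_rel h (fst (\<sigma>, ?c div 2)) (snd (\<sigma>, ?c div 2)) (Pt p x) (Pt q y) (Pt r z)"
      unfolding block_rel_transversal[OF pqr(4-6)] using \<sigma> xyz by auto
  next
    fix j assume j: "j \<in> {..<N} \<times> {..<h} \<and> block_rel h (fst j) (snd j) (Pt p x) (Pt q y) (Pt r z)"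
    then obtain e where e: "T (fst j) p q r e" "?c = 2 * snd j + e"
      unfolding block_rel_transversal[OF pqr(4-6)] by blast
    have jN: "fst j < N" using j by auto
    have "e < 2" using T_dom[OF jN e(1)] by simp
    then have "?c div 2 = snd j" "?c mod 2 = e" using e(2) by auto
    then show "j = (\<sigma>, ?c div 2)" using u[of "fst j"] jN e(1) by (metis prod.collapse)
  qed
qed

lemma ex1_fold:
  assumes h: "0 < h" and pq: "p < N" "q < N" "p mod n \<noteq> q mod n"
    and xyz: "x < 2 * h" "y < 2 * h" "z < 2 * h" "x \<noteq> y"
  shows "\<exists>!j. j \<in> {..<N} \<times> {..<h} \<and> block_rel h (fst j) (snd j) (Pt p x) (Pt p y) (Pt q z)"
proof -
  obtain \<sigma> where \<sigma>: "\<sigma> < N \<and> A \<sigma> p q" and u: "\<And>\<tau>. \<tau> < N \<and> A \<tau> p q \<Longrightarrow> \<tau> = \<sigma>"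
    using A_once[OF pq] by (rule ex1E) blast
  have ne: "p \<noteq> q" using pq by auto
  let ?c = "((x + y + 1) div 2) mod h"
  have c: "?c < h" using h by simp
  obtain s where s: "s < h \<and> (z + ord_bit p q + s) mod h = ?c"
    and su: "\<And>t. t < h \<and> (z + ord_bit p q + t) mod h = ?c \<Longrightarrow> t = s"
    using ex1_add_mod[OF c] by (rule ex1E) blast
  have iff: "block_rel h \<tau> t (Pt p x) (Pt p y) (Pt q z) \<longleftrightarrow> A \<tau> p q \<and> (z + ord_bit p q + t) mod h = ?c" if "\<tau> < N" for \<tau> t
    unfolding block_rel_fold[OF that ne] fold3_def using xyz by (auto simp: ac_simps)
  show ?thesis
  proof (rule ex1I[of _ "(\<sigma>, s)"])
    show "(\<sigma>, s) \<in> {..<N} \<times> {..<h} \<and> block_rel h (fst (\<sigma>, s)) (snd (\<sigma>, s)) (Pt p x) (Pt p y) (Pt q z)"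
      using \<sigma> s iff[of \<sigma> s] by simp
  next
    fix j assume j: "j \<in> {..<N} \<times> {..<h} \<and> block_rel h (fst j) (snd j) (Pt p x) (Pt p y) (Pt q z)"
    then have "fst j < N" "snd j < h" by auto
    then show "j = (\<sigma>, s)" using j iff[of "fst j" "snd j"] u[of "fst j"] su[of "snd j"] by (metis prod.collapse)
  qed
qed

lemma ex1_tail:
  assumes h: "0 < h" and pq: "p < N" "q < N" "p mod n \<noteq> q mod n" "p < q" and xz: "x < 2 * h" "z < 2 * h"
  shows "\<exists>!j. j \<in> {..<N} \<times> {..<h} \<and> block_rel h (fst j) (snd j) (Ideal b) (Pt p x) (Pt q z)"
proof -
  obtain \<sigma> where \<sigma>: "\<sigma> < N \<and> A \<sigma> p q" and u: "\<And>\<tau>. \<tau> < N \<and> A \<tau> p q \<Longrightarrow> \<tau> = \<sigma>"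
    using A_once[OF pq(1-3)] by (rule ex1E) blast
  obtain \<sigma>' where \<sigma>': "\<sigma>' < N \<and> A \<sigma>' q p" and u': "\<And>\<tau>. \<tau> < N \<and> A \<tau> q p \<Longrightarrow> \<tau> = \<sigma>'"
    using A_once[OF pq(2,1) pq(3)[symmetric]] by (rule ex1E) blast
  define k where "k = z + ord_bit p q + (if b then h else 0)"
  obtain d where d: "d < 2 * h \<and> (k + d) mod (2 * h) = x"
    and du: "\<And>t. t < 2 * h \<and> (k + t) mod (2 * h) = x \<Longrightarrow> t = d"
    using ex1_add_mod[OF xz(1)] by (rule ex1E) blast
  have out: "x = (z + s + ord_bit p q + (if b then h else 0)) mod (2 * h) \<longleftrightarrow> s = d" if "s < h" for s
  proof -
    have eq: "z + s + ord_bit p q + (if b then h else 0) = k + s" by (simp add: k_def)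
    have "s = d" if "x = (k + s) mod (2 * h)" using that \<open>s < h\<close> by (intro du) simp
    moreover have "x = (k + d) mod (2 * h)" using d by simp
    ultimately show ?thesis unfolding eq by blast
  qed
  have inn: "z = (x + s + ord_bit q p + (if b then h else 0)) mod (2 * h) \<longleftrightarrow> s + d + 1 = 2 * h" if "s < h" for s
  proof -
    have "(x + s + ord_bit q p + (if b then h else 0)) mod (2 * h) =
        ((k + d) mod (2 * h) + (s + 1 + (if b then h else 0))) mod (2 * h)"
      using pq(4) d by (simp add: ord_bit_def ac_simps)
    also have "\<dots> = (k + d + (s + 1 + (if b then h else 0))) mod (2 * h)"
      by (rule mod_add_left_eq)
    also have "k + d + (s + 1 + (if b then h else 0)) = z + (s + d + 1) + (if b then 1 else 0) * (2 * h)"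
      using pq(4) by (simp add: k_def ord_bit_def)
    also have "\<dots> mod (2 * h) = (z + (s + d + 1)) mod (2 * h)" by (rule mod_mult_self1)
    finally have eq: "(x + s + ord_bit q p + (if b then h else 0)) mod (2 * h) = (z + (s + d + 1)) mod (2 * h)" .
    have "z = (z + (s + d + 1)) mod (2 * h) \<longleftrightarrow> [z + 0 = z + (s + d + 1)] (mod 2 * h)"
      using xz(2) by (simp add: cong_def)
    also have "\<dots> \<longleftrightarrow> 2 * h dvd s + d + 1"
      unfolding cong_add_lcancel_nat cong_0_iff[symmetric] by (rule cong_sym_eq)
    also have "\<dots> \<longleftrightarrow> s + d + 1 = 2 * h"
    proof
      assume "2 * h dvd s + d + 1"
      then obtain c where c: "s + d + 1 = 2 * h * c" ..
      then have "2 * h * c < 2 * h * 2" using that d by linarith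
      then have "c < 2" using h by simp
      moreover have "c \<noteq> 0" using c by (intro notI) simp
      ultimately have "c = 1" by simp
      then show "s + d + 1 = 2 * h" using c by simp
    qed simp
    finally show ?thesis unfolding eq .
  qed
  have iff: "block_rel h \<tau> t (Ideal b) (Pt p x) (Pt q z) \<longleftrightarrow> (\<tau> = \<sigma> \<and> t = d) \<or> (\<tau> = \<sigma>' \<and> t + d + 1 = 2 * h)"
    if "\<tau> < N" "t < h" for \<tau> t
    using out[OF that(2)] inn[OF that(2)] \<sigma> \<sigma>' u[of \<tau>] u'[of \<tau>] that(1) xz by (auto simp: tail3_def)
  define j0 where "j0 = (if d < h then (\<sigma>, d) else (\<sigma>', 2 * h - 1 - d))"
  show ?thesis
  proof (rule ex1I[of _ j0])
    show "j0 \<in> {..<N} \<times> {..<h} \<and> block_rel h (fst j0) (snd j0) (Ideal b) (Pt p x) (Pt q z)"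
      using \<sigma> \<sigma>' iff[of \<sigma> d] iff[of \<sigma>' "2 * h - 1 - d"] d by (auto simp: j0_def)
  next
    fix j assume j: "j \<in> {..<N} \<times> {..<h} \<and> block_rel h (fst j) (snd j) (Ideal b) (Pt p x) (Pt q z)"
    then have "fst j < N" "snd j < h" by auto
    then show "j = j0" using j iff[of "fst j" "snd j"] d by (auto simp: j0_def prod_eq_iff)
  qed
qed

definition pts :: "nat \<Rightarrow> nat set \<Rightarrow> point set" where
  "pts h P = range Ideal \<union> (\<lambda>(p, x). Pt p x) ` (P \<times> {..<2 * h})"

lemma Ideal_in_pts: "Ideal b \<in> pts h P"
  and Pt_in_pts: "Pt p x \<in> pts h P \<longleftrightarrow> p \<in> P \<and> x < 2 * h"
  by (auto simp: pts_def)

lemma card_pts: "finite P \<Longrightarrow> card (pts h P) = card P * (2 * h) + 2"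
  and finite_pts: "finite P \<Longrightarrow> finite (pts h P)"
proof -
  assume P: "finite P"
  show "finite (pts h P)" using P by (auto simp: pts_def)
  have "card (range Ideal) = 2" by (simp add: card_image inj_on_def)
  moreover have "card ((\<lambda>(p, x). Pt p x) ` (P \<times> {..<2 * h})) = card P * (2 * h)"
    by (subst card_image) (auto simp: inj_on_def card_cartesian_product)
  ultimately show "card (pts h P) = card P * (2 * h) + 2"
    unfolding pts_def using P by (subst card_Un_disjoint) auto
qed

definition group :: "nat \<Rightarrow> nat set" where
  "group i = {p. p < N \<and> p mod n = i}"

lemma finite_group: "finite (group i)" by (auto simp: group_def)

lemma card_group: "i < n \<Longrightarrow> card (group i) = g"
proof -
  assume i: "i < n"
  have "group i = (\<lambda>a. i + n * a) ` {..<g}"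
  proof (intro equalityI subsetI)
    fix p assume p: "p \<in> group i"
    then have "p < N" by (simp add: group_def)
    then have "p < g * n" by (simp only: N_eq mult.commute)
    then have "p div n < g" by (rule less_mult_imp_div_less)
    moreover have "p = i + n * (p div n)" using p by (auto simp: group_def)
    ultimately show "p \<in> (\<lambda>a. i + n * a) ` {..<g}" by blast
  next
    fix p assume "p \<in> (\<lambda>a. i + n * a) ` {..<g}"
    then obtain a where a: "a < g" "p = i + n * a" by auto
    have "n * a + n \<le> n * g" using mult_le_mono2[of "Suc a" g n] a(1) by simp
    then have "i + n * a < N" unfolding N_eq using i by linarith
    then show "p \<in> group i" using a i by (simp add: group_def)
  qed
  then show ?thesis using n_pos by (simp add: card_image inj_on_def)
qed

lemma block_rel_pts:
  assumes \<sigma>: "\<sigma> < N" and r: "block_rel h \<sigma> s u v w"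
  shows "u \<in> pts h {..<N} \<and> v \<in> pts h {..<N} \<and> w \<in> pts h {..<N}"
    and "\<not> {u, v, w} \<subseteq> pts h (group i)"
proof -
  have T3: "p < N \<and> q < N \<and> r < N \<and> \<not> (p mod n = q mod n \<and> p mod n = r mod n)"
    if "T \<sigma> p q r e" for p q r e
    using T_dom[OF \<sigma> that] T_group[OF \<sigma> that] by auto
  have A2: "p < N \<and> q < N \<and> p mod n \<noteq> q mod n" if "A \<sigma> p q" for p q using A_dom[OF \<sigma> that] by auto
  show "u \<in> pts h {..<N} \<and> v \<in> pts h {..<N} \<and> w \<in> pts h {..<N}"
    using r by (cases u; cases v; cases w)
      (auto simp: Ideal_in_pts Pt_in_pts fold3_def tail3_def dest: T3 A2)
  have T3': "r mod n \<noteq> i" if "T \<sigma> p q r e" "p mod n = i" "q mod n = i" for p q r e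
    using T_group[OF \<sigma> that(1)] that(2,3) by simp
  have A2': "q mod n \<noteq> i" if "A \<sigma> p q" "p mod n = i" for p q
    using A_dom[OF \<sigma> that(1)] that(2) by simp
  show "\<not> {u, v, w} \<subseteq> pts h (group i)"
    using r by (cases u; cases v; cases w)
      (auto simp: Ideal_in_pts Pt_in_pts group_def fold3_def tail3_def dest: T3' A2')
qed

lemma block_rel_hole:
  assumes \<sigma>: "\<sigma> < N" and r: "block_rel h \<sigma> s u v w"
  shows "\<not> {u, v} \<subseteq> pts h (group (\<sigma> mod n))"
proof -
  have T3: "\<not> (p mod n = \<sigma> mod n \<and> q mod n = \<sigma> mod n)" "\<not> (p mod n = \<sigma> mod n \<and> r mod n = \<sigma> mod n)"
    if "T \<sigma> p q r e" for p q r e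
    using T_hole[OF \<sigma> that] T_hole[OF \<sigma> T_swap23[OF \<sigma> that]] by auto
  have A2: "p mod n \<noteq> \<sigma> mod n" "q mod n \<noteq> \<sigma> mod n" if "A \<sigma> p q" for p q using A_dom[OF \<sigma> that] by auto
  show ?thesis
    using r by (cases u; cases v; cases w)
      (auto simp: Ideal_in_pts Pt_in_pts group_def fold3_def tail3_def dest: T3 A2)
qed

lemma card_completions:
  assumes \<sigma>: "\<sigma> < N" and s: "s < h" and u: "u \<in> pts h {..<N}" and v: "v \<in> pts h {..<N}" and uv: "u \<noteq> v"
  shows "card {w. block_rel h \<sigma> s u v w} = (if {u, v} \<subseteq> pts h (group (\<sigma> mod n)) then 0 else 2)"
proof -
  have h: "0 < h" using s by simp
  have sw: "card {w. block_rel h \<sigma> s u v w} = card {w. block_rel h \<sigma> s v u w}" for u v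
    using block_rel_swap12[OF \<sigma>] by (intro arg_cong[where f=card]) blast
  have "card {w. block_rel h \<sigma> s u v w} = 2" if "\<not> {u, v} \<subseteq> pts h (group (\<sigma> mod n))"
  proof (cases u)
    case (Ideal b)
    show ?thesis
    proof (cases v)
      case (Pt p x) then show ?thesis
        using that v Ideal completions_Ideal[OF \<sigma> h, of p x s b] by (simp add: Ideal_in_pts Pt_in_pts group_def)
    qed (use Ideal that in \<open>simp add: Ideal_in_pts\<close>)
  next
    case u': (Pt p x)
    show ?thesis
    proof (cases v)
      case (Ideal b) then show ?thesis
        using that u u' completions_Ideal[OF \<sigma> h, of p x s b] sw by (simp add: Ideal_in_pts Pt_in_pts group_def)
    next
      case v': (Pt q y)
      have pq: "p < N" "q < N" "x < 2 * h" "y < 2 * h" using u v u' v' by (auto simp: Pt_in_pts)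
      have hole: "p mod n \<noteq> \<sigma> mod n \<or> q mod n \<noteq> \<sigma> mod n"
        using that pq by (auto simp: u' v' Pt_in_pts group_def)
      consider "p = q" | "A \<sigma> p q" | "A \<sigma> q p" | "p \<noteq> q" "\<not> A \<sigma> p q" "\<not> A \<sigma> q p" by blast
      then show ?thesis
      proof cases
        case 1 then show ?thesis using completions_fibre[OF \<sigma> h pq(1)] hole pq uv u' v' by auto
      next
        case 2 then show ?thesis using completions_arc[OF \<sigma> h] pq u' v' by auto
      next
        case 3 then show ?thesis using completions_arc[OF \<sigma> h 3 pq(4,3)] sw[of u v] by (simp add: u' v')
      next
        case 4 then show ?thesis using completions_cover[OF \<sigma> s pq(1,2) _ hole] pq u' v' by auto
      qed
    qed
  qed
  moreover have "{w. block_rel h \<sigma> s u v w} = {}" if "{u, v} \<subseteq> pts h (group (\<sigma> mod n))"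
    using block_rel_hole[OF \<sigma>] that by blast
  ultimately show ?thesis by auto
qed

lemma ex1_block_rel:
  assumes h: "0 < h" and uvw: "u \<in> pts h {..<N}" "v \<in> pts h {..<N}" "w \<in> pts h {..<N}"
    and d: "u \<noteq> v" "u \<noteq> w" "v \<noteq> w" and out: "\<And>i. i < n \<Longrightarrow> \<not> {u, v, w} \<subseteq> pts h (group i)"
  shows "\<exists>!j. j \<in> {..<N} \<times> {..<h} \<and> block_rel h (fst j) (snd j) u v w"
proof -
  define E where "E u v w \<longleftrightarrow> (\<exists>!j. j \<in> {..<N} \<times> {..<h} \<and> block_rel h (fst j) (snd j) u v w)" for u v w
  have r12: "block_rel h \<sigma> s u v w \<longleftrightarrow> block_rel h \<sigma> s v u w" if "\<sigma> < N" for \<sigma> s u v w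
    using block_rel_swap12[OF that] by blast
  have r23: "block_rel h \<sigma> s u v w \<longleftrightarrow> block_rel h \<sigma> s u w v" if "\<sigma> < N" for \<sigma> s u v w
    using block_rel_swap23[OF that] by blast
  have e12: "E u v w \<longleftrightarrow> E v u w" for u v w
    unfolding E_def by (intro arg_cong[where f=Ex1] ext conj_cong refl r12) auto
  have e23: "E u v w \<longleftrightarrow> E u w v" for u v w
    unfolding E_def by (intro arg_cong[where f=Ex1] ext conj_cong refl r23) auto
  have in_group: "p \<in> group (p mod n)" "p mod n < n" if "p < N" for p using that n_pos by (auto simp: group_def)
  have IPP: "E (Ideal b) (Pt p x) (Pt q y)" if "p < N" "q < N" "x < 2 * h" "y < 2 * h" "p mod n \<noteq> q mod n" for b p q x y
  proof (cases "p < q")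
    case True then show ?thesis unfolding E_def using ex1_tail[OF h] that by blast
  next
    case False
    then have "q < p" using that(5) by (cases "p = q") auto
    then have "E (Ideal b) (Pt q y) (Pt p x)" unfolding E_def using ex1_tail[OF h that(2,1) that(5)[symmetric]] that by blast
    then show ?thesis using e23 by blast
  qed
  have PPP: "E (Pt p x) (Pt p y) (Pt q z)"
    if "p < N" "q < N" "x < 2 * h" "y < 2 * h" "z < 2 * h" "p mod n \<noteq> q mod n" "x \<noteq> y" for p q x y z
    unfolding E_def by (rule ex1_fold[OF h that(1,2,6,3,4,5,7)])
  have "E u v w"
  proof (cases u)
    case u': (Ideal a)
    show ?thesis
    proof (cases v)
      case (Ideal b) then show ?thesis
        using out u' uvw in_group out[of 0] n_pos by (cases w) (force simp: Ideal_in_pts Pt_in_pts)+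
    next
      case v': (Pt q y)
      show ?thesis
      proof (cases w)
        case (Ideal b) then show ?thesis
          using out[of "q mod n"] u' v' uvw in_group by (auto simp: Ideal_in_pts Pt_in_pts)
      next
        case w': (Pt r z)
        then show ?thesis
          using out[of "q mod n"] u' v' uvw in_group IPP[of q r y z a] by (auto simp: Ideal_in_pts Pt_in_pts group_def)
      qed
    qed
  next
    case u': (Pt p x)
    have p: "p < N" "x < 2 * h" using uvw(1) by (auto simp: u' Pt_in_pts)
    note outp = out[OF in_group(2)[OF p(1)]]
    show ?thesis
    proof (cases v)
      case v': (Ideal b)
      show ?thesis
      proof (cases w)
        case (Ideal c) then show ?thesis
          using outp u' v' p in_group by (auto simp: Ideal_in_pts Pt_in_pts)
      next
        case w': (Pt r z)
        then have "E v u w"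
          using outp u' v' uvw in_group IPP[of p r x z b] by (auto simp: Ideal_in_pts Pt_in_pts group_def)
        then show ?thesis using e12 by blast
      qed
    next
      case v': (Pt q y)
      have q: "q < N" "y < 2 * h" using uvw(2) by (auto simp: v' Pt_in_pts)
      show ?thesis
      proof (cases w)
        case w': (Ideal c)
        then have "E w u v"
          using outp u' v' p q in_group IPP[of p q x y c] by (auto simp: Ideal_in_pts Pt_in_pts group_def)
        then show ?thesis using e12 e23 by blast
      next
        case w': (Pt r z)
        have r: "r < N" "z < 2 * h" using uvw(3) by (auto simp: w' Pt_in_pts)
        have nin: "\<not> (p mod n = q mod n \<and> p mod n = r mod n)"
          using outp p q r by (auto simp: u' v' w' Pt_in_pts group_def)
        consider "p = q" | "p = r" | "q = r" | "p \<noteq> q" "p \<noteq> r" "q \<noteq> r" by blast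
        then show ?thesis
        proof cases
          case 1
          then show ?thesis using PPP[of p r x y z] p q r nin d(1) by (simp add: u' v' w')
        next
          case 2
          then have "E u w v" using PPP[of p q x z y] p q r nin d(2) by (simp add: u' v' w')
          then show ?thesis using e23 by blast
        next
          case 3
          then have "E v w u" using PPP[of q p y z x] p q r nin d(3) by (simp add: u' v' w')
          then show ?thesis using e12 e23 by blast
        next
          case 4
          then show ?thesis unfolding E_def u' v' w'
            using ex1_T[OF h p(1) q(1) r(1) _ _ _ nin p(2) q(2) r(2)] by blast
        qed
      qed
    qed
  qed
  then show ?thesis unfolding E_def .
qed

theorem LS_exists_inflate:
  assumes K: "3 \<in> K" "\<And>k. k \<in> K \<Longrightarrow> 3 \<le> k" and h: "0 < h" and LS: "LS_exists K (g * (2 * h) + 2)"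
  shows "LS_exists K (N * (2 * h) + 2)"
proof -
  let ?X = "pts h {..<N}" and ?J = "{..<N} \<times> {..<h}"
  have cX: "card ?X = N * (2 * h) + 2" by (simp add: card_pts)
  have LS': "\<exists>B :: nat \<Rightarrow> nat set multiset.
      is_LS_star 2 K (g * (2 * h) + 2) {..<g * (2 * h) + 2} {..<g * h} B"
    using LS by (simp add: LS_exists_def)
  then obtain B :: "nat \<Rightarrow> nat set multiset" where
    B: "is_LS_star 2 K (g * (2 * h) + 2) {..<g * (2 * h) + 2} {..<g * h} B" ..
  have tr: "triple_relation (block_rel h (fst j) (snd j))" if "j \<in> ?J" for j
    using that triple_relation_block_rel by auto
  have "\<exists>B'. is_LS_star 2 K (card ?X) ?X ?J B'"
  proof (rule is_LS_star_fill[OF B K, where I="{..<n}" and L="\<lambda>i. pts h (group i)"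
        and S="\<lambda>j. triples_of (block_rel h (fst j) (snd j))" and \<rho>="\<lambda>j. fst j mod n"
        and \<tau>="\<lambda>j. (fst j div n) * h + snd j"])
    show "finite ?X" by (simp add: finite_pts)
    show "finite ?J" by simp
    show "pts h (group i) \<subseteq> ?X" for i by (auto simp: pts_def group_def)
    show "card (pts h (group i)) = g * (2 * h) + 2" if "i \<in> {..<n}" for i
      using that by (simp add: card_pts finite_group card_group)
    show "card (pts h (group i) \<inter> pts h (group i')) \<le> 2" if "i \<noteq> i'" for i i'
    proof -
      have "pts h (group i) \<inter> pts h (group i') \<subseteq> range Ideal"
        using that by (auto simp: pts_def group_def)
      then have "card (pts h (group i) \<inter> pts h (group i')) \<le> card (range Ideal)"
        by (intro card_mono) auto
      also have "\<dots> = 2" by (simp add: card_image inj_on_def)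
      finally show ?thesis .
    qed
    show "fst j mod n \<in> {..<n}" for j :: "nat \<times> nat" using n_pos by simp
    show "bij_betw (\<lambda>j. (fst j div n) * h + snd j) {j \<in> ?J. fst j mod n = i} {..<g * h}"
      if "i \<in> {..<n}" for i
    proof (rule bij_betw_byWitness[where f'="\<lambda>q. (i + n * (q div h), q mod h)"])
      show "\<forall>j\<in>{j \<in> ?J. fst j mod n = i}.
          (i + n * ((fst j div n * h + snd j) div h), (fst j div n * h + snd j) mod h) = j"
        by auto
      show "\<forall>q\<in>{..<g * h}. fst (i + n * (q div h), q mod h) div n * h + snd (i + n * (q div h), q mod h) = q"
        using that n_pos by auto
      show "(\<lambda>j. (fst j div n) * h + snd j) ` {j \<in> ?J. fst j mod n = i} \<subseteq> {..<g * h}"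
      proof clarsimp
        fix a b assume "a < N" "b < h"
        then have "a < g * n" using N_eq by (simp add: mult.commute)
        then have "a div n < g" by (rule less_mult_imp_div_less)
        then have "Suc (a div n) * h \<le> g * h" by (intro mult_le_mono1) simp
        then show "a div n * h + b < g * h" using \<open>b < h\<close> by simp
      qed
      show "(\<lambda>q. (i + n * (q div h), q mod h)) ` {..<g * h} \<subseteq> {j \<in> ?J. fst j mod n = i}"
      proof clarsimp
        fix q assume "q < g * h"
        then have "q div h < g" by (simp add: less_mult_imp_div_less)
        then have "n * Suc (q div h) \<le> n * g" by (intro mult_le_mono2) simp
        then show "i + n * (q div h) < N \<and> q mod h < h \<and> i mod n = i" using that h by (simp add: N_eq)
      qed
    qed
    show "b \<subseteq> ?X \<and> card b = 3 \<and> (\<forall>i\<in>{..<n}. \<not> b \<subseteq> pts h (group i))"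
      if j: "j \<in> ?J" and b: "b \<in> triples_of (block_rel h (fst j) (snd j))" for j b
    proof -
      obtain u v w where uvw: "b = {u, v, w}" "block_rel h (fst j) (snd j) u v w" using b by (auto simp: triples_of_def)
      have \<sigma>: "fst j < N" using j by auto
      show ?thesis
        using triple_relation.card_triples_of[OF tr[OF j] b] block_rel_pts[OF \<sigma> uvw(2)] unfolding uvw(1) by blast
    qed
    show "card {b \<in> triples_of (block_rel h (fst j) (snd j)). P \<subseteq> b} =
        (if P \<subseteq> pts h (group (fst j mod n)) then 0 else 2)"
      if j: "j \<in> ?J" and P: "P \<subseteq> ?X" "card P = 2" for j P
    proof -
      obtain u v where uv: "P = {u, v}" "u \<noteq> v" using P(2) by (auto simp: card_2_iff)
      show ?thesis
        unfolding uv(1) triple_relation.card_triples_of_through[OF tr[OF j] uv(2)]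
        using j P(1) uv by (intro card_completions) auto
    qed
    show "\<exists>!j. j \<in> ?J \<and> t \<in> triples_of (block_rel h (fst j) (snd j))"
      if t: "t \<subseteq> ?X" "card t = 3" "\<And>i. i \<in> {..<n} \<Longrightarrow> \<not> t \<subseteq> pts h (group i)" for t
    proof -
      obtain u v w where uvw: "t = {u, v, w}" "u \<noteq> v" "u \<noteq> w" "v \<noteq> w" using t(2) by (auto simp: card_3_iff)
      have "(j \<in> ?J \<and> t \<in> triples_of (block_rel h (fst j) (snd j))) \<longleftrightarrow> (j \<in> ?J \<and> block_rel h (fst j) (snd j) u v w)" for j
        unfolding uvw(1) using triple_relation.mem_triples_of[OF tr] by blast
      moreover have "\<exists>!j. j \<in> ?J \<and> block_rel h (fst j) (snd j) u v w"
        using t(1,3) uvw by (intro ex1_block_rel[OF h]) auto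
      ultimately show ?thesis by simp
    qed
  qed
  then obtain B' where B': "is_LS_star 2 K (card ?X) ?X ?J B'" ..
  have "card ?J = (card ?X - 2) div 2" unfolding cX by simp
  from LS_existsI[OF B' this K] show ?thesis by (simp only: cX)
qed

end

section \<open>Tagged frames\<close>

lemma ex1_mult_mod:
  fixes a n c :: nat
  assumes "coprime a n" "0 < n"
  shows "\<exists>!x. x < n \<and> (a * x) mod n = c mod n"
proof (rule ex_ex1I)
  obtain b where "[a * b = 1] (mod n)" using cong_solve_coprime_nat[OF assms(1)] by auto
  then have "[a * b * c = 1 * c] (mod n)" by (rule cong_mult) simp
  then have "(a * ((b * c) mod n)) mod n = c mod n" by (simp add: cong_def mod_mult_right_eq mult.assoc)
  then show "\<exists>x. x < n \<and> (a * x) mod n = c mod n" using assms(2) by (intro exI[of _ "(b * c) mod n"]) simp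
next
  fix x y assume x: "x < n \<and> (a * x) mod n = c mod n" and y: "y < n \<and> (a * y) mod n = c mod n"
  then have "[a * x = a * y] (mod n)" by (simp add: cong_def)
  then have "[x = y] (mod n)" using assms(1) by (simp add: cong_mult_lcancel_nat)
  then show "x = y" using x y by (simp add: cong_def)
qed

lemma tagged_frame_coprime6:
  assumes n: "0 < n" and co: "coprime n 6"
  shows "tagged_frame n n 1
    (\<lambda>\<sigma> p q r e. p < n \<and> q < n \<and> r < n \<and> p \<noteq> q \<and> p \<noteq> r \<and> q \<noteq> r \<and> e < 2 \<and> [p + q + r = 3 * \<sigma>] (mod n))
    (\<lambda>\<sigma> p q. p < n \<and> q < n \<and> p \<noteq> \<sigma> \<and> [2 * p + q = 3 * \<sigma>] (mod n))"
proof -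
  have co2: "coprime 2 n" and co3: "coprime 3 n"
    using co coprime_mult_right_iff[of n 2 3] by (simp_all add: coprime_commute)
  have eq: "x = y" if "[x = y] (mod n)" "x < n" "y < n" for x y :: nat
    using that by (simp add: cong_def)
  have sub: "x = y" if "[a + x = a + y] (mod n)" "x < n" "y < n" for a x y :: nat
    using that eq by (simp add: cong_add_lcancel_nat)
  have div2: "x = y" if "[2 * x = 2 * y] (mod n)" "x < n" "y < n" for x y :: nat
    using that co2 eq by (simp add: cong_mult_lcancel_nat)
  have div3: "x = y" if "[3 * x = 3 * y] (mod n)" "x < n" "y < n" for x y :: nat
    using that co3 eq by (simp add: cong_mult_lcancel_nat)
  have ne: "q \<noteq> \<sigma> \<and> q \<noteq> p" if "p < n" "\<sigma> < n" "p \<noteq> \<sigma>" "[2 * p + q = 3 * \<sigma>] (mod n)" for p q \<sigma>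
  proof (intro conjI notI)
    assume "q = \<sigma>"
    then have "[\<sigma> + 2 * p = \<sigma> + 2 * \<sigma>] (mod n)" using that(4) by (simp add: add.commute)
    then have "[2 * p = 2 * \<sigma>] (mod n)" by (simp only: cong_add_lcancel_nat)
    then show False using div2 that by blast
  next
    assume "q = p"
    then show False using div3 that by simp
  qed
  have third: "\<exists>!r. r < n \<and> [k + r = c] (mod n)" for k c
    using ex1_add_mod[of "c mod n" n k] n by (simp add: cong_def)
  show ?thesis
  proof (unfold_locales, goal_cases)
    case (7 \<sigma> p q r e) then show ?case by auto
  next
    case (8 \<sigma> p q) then show ?case using ne[of p \<sigma> q] by auto
  next
    case (9 \<sigma> p q)
    show ?case
    proof
      assume "q < n \<and> p < n \<and> q \<noteq> \<sigma> \<and> [2 * q + p = 3 * \<sigma>] (mod n)"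
      then have "[2 * q + p = 2 * p + q] (mod n)" using 9 cong_trans cong_sym by blast
      then have "[(p + q) + q = (p + q) + p] (mod n)" by (simp only: mult_2 add_ac)
      then show False using sub[of "p + q" q p] ne[of p \<sigma> q] 9 by blast
    qed
  next
    case (10 \<sigma> p q r e)
    show ?case
    proof
      assume r: "p < n \<and> q < n \<and> r < n \<and> p \<noteq> q \<and> p \<noteq> r \<and> q \<noteq> r \<and> e < 2 \<and> [p + q + r = 3 * \<sigma>] (mod n)"
      then have "[p + q + r = 2 * p + q] (mod n)" using 10 cong_trans cong_sym by blast
      then have "[(p + q) + r = (p + q) + p] (mod n)" by (simp only: mult_2 add_ac)
      then show False using sub[of "p + q" r p] r by blast
    qed
  next
    case (11 \<sigma> p q)
    obtain r where r: "r < n" "[p + q + r = 3 * \<sigma>] (mod n)"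
      and u: "\<And>t. t < n \<Longrightarrow> [p + q + t = 3 * \<sigma>] (mod n) \<Longrightarrow> t = r"
      using third[of "p + q" "3 * \<sigma>"] by blast
    have "r \<noteq> p \<and> r \<noteq> q"
    proof (intro conjI notI)
      assume "r = p"
      then have c: "[2 * p + q = 3 * \<sigma>] (mod n)" using r(2) by (simp only: mult_2 add_ac)
      then have "p = \<sigma>" using 11 by blast
      then have "[2 * \<sigma> + q = 2 * \<sigma> + \<sigma>] (mod n)" using c by simp
      then have "q = \<sigma>" using sub 11 by blast
      then show False using \<open>p = \<sigma>\<close> 11 by blast
    next
      assume "r = q"
      then have c: "[2 * q + p = 3 * \<sigma>] (mod n)" using r(2) by (simp only: mult_2 add_ac)
      then have "q = \<sigma>" using 11 by blast
      then have "[2 * \<sigma> + p = 2 * \<sigma> + \<sigma>] (mod n)" using c by simp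
      then have "p = \<sigma>" using sub 11 by blast
      then show False using \<open>q = \<sigma>\<close> 11 by blast
    qed
    then have iff: "t < n \<and> p \<noteq> t \<and> q \<noteq> t \<and> [p + q + t = 3 * \<sigma>] (mod n) \<longleftrightarrow> t = r" for t
      using r u by blast
    have "{(r, e). p < n \<and> q < n \<and> r < n \<and> p \<noteq> q \<and> p \<noteq> r \<and> q \<noteq> r \<and> e < 2 \<and>
        [p + q + r = 3 * \<sigma>] (mod n)} = {r} \<times> {..<2::nat}"
    proof (intro set_eqI)
      fix c show "c \<in> {(r, e). p < n \<and> q < n \<and> r < n \<and> p \<noteq> q \<and> p \<noteq> r \<and> q \<noteq> r \<and> e < 2 \<and>
        [p + q + r = 3 * \<sigma>] (mod n)} \<longleftrightarrow> c \<in> {r} \<times> {..<2::nat}"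
        using 11(2-4) iff[of "fst c"] unfolding case_prod_beta mem_Collect_eq mem_Times_iff singleton_iff lessThan_iff by blast
    qed
    then show ?case by (simp only: card_cartesian_product) simp
  next
    case (12 \<sigma> p)
    then show ?case using third[of "2 * p" "3 * \<sigma>"] by simp
  next
    case (13 \<sigma> p)
    have "\<exists>!q. q < n \<and> [p + 2 * q = 3 * \<sigma>] (mod n)"
    proof -
      obtain c where c: "[p + c = 3 * \<sigma>] (mod n)" using third[of p "3 * \<sigma>"] by blast
      have "[p + 2 * q = 3 * \<sigma>] (mod n) \<longleftrightarrow> (2 * q) mod n = c mod n" for q
      proof -
        have "[p + 2 * q = 3 * \<sigma>] (mod n) \<longleftrightarrow> [p + 2 * q = p + c] (mod n)"
          using c cong_trans cong_sym by blast
        then show ?thesis unfolding cong_add_lcancel_nat by (simp add: cong_def)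
      qed
      then show ?thesis using ex1_mult_mod[OF co2 n, of c] by simp
    qed
    moreover have "q \<noteq> \<sigma>" if "[p + 2 * q = 3 * \<sigma>] (mod n)" for q
    proof
      assume "q = \<sigma>"
      then have "[2 * \<sigma> + p = 2 * \<sigma> + \<sigma>] (mod n)" using that by (simp add: add.commute)
      then show False using sub[of "2 * \<sigma>" p \<sigma>] 13 by simp
    qed
    ultimately show ?case using 13 by (simp add: add.commute[of p]) blast
  next
    case (14 p q r e)
    then show ?case using ex1_mult_mod[OF co3 n, of "p + q + r"] by (simp add: cong_def eq_commute)
  next
    case (15 p q)
    then have pq: "p < n" "q < n" "p \<noteq> q" by auto
    have "p \<noteq> \<sigma>" if "[2 * p + q = 3 * \<sigma>] (mod n)" for \<sigma>
    proof
      assume "p = \<sigma>"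
      then have "[2 * p + q = 2 * p + p] (mod n)" using that by simp
      then show False using sub[of "2 * p" q p] pq by blast
    qed
    moreover have "\<exists>!\<sigma>. \<sigma> < n \<and> [2 * p + q = 3 * \<sigma>] (mod n)"
      using ex1_mult_mod[OF co3 n, of "2 * p + q"] by (simp add: cong_def eq_commute)
    ultimately show ?case using pq by blast
  qed (use n in \<open>auto simp: ac_simps\<close>)
qed

text \<open>Phrased with list combinators and lazy conditionals so that \<open>code_simp\<close> can evaluate it.\<close>

definition frame_check ::
    "nat \<Rightarrow> nat \<Rightarrow> (nat \<Rightarrow> nat \<Rightarrow> nat \<Rightarrow> (nat \<times> nat) list) \<Rightarrow> (nat \<Rightarrow> nat \<Rightarrow> nat) \<Rightarrow> bool" where
  "frame_check N n third arc \<longleftrightarrow>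
     list_all (\<lambda>\<sigma>. list_all (\<lambda>p. list_all (\<lambda>q. list_all (\<lambda>(r, e).
       r < N \<and> e < 2 \<and> p \<noteq> q \<and> List.member (third \<sigma> q p) (r, e) \<and> List.member (third \<sigma> p r) (q, e) \<and>
       (p mod n = q mod n \<longrightarrow> p mod n \<noteq> r mod n) \<and> (p mod n = \<sigma> mod n \<longrightarrow> q mod n \<noteq> \<sigma> mod n))
       (third \<sigma> p q)) [0..<N]) [0..<N]) [0..<N] \<and>
     list_all (\<lambda>\<sigma>. list_all (\<lambda>p. if p mod n = \<sigma> mod n then True else
       arc \<sigma> p < N \<and> arc \<sigma> p mod n \<noteq> p mod n \<and> arc \<sigma> p mod n \<noteq> \<sigma> mod n \<and> arc \<sigma> (arc \<sigma> p) \<noteq> p \<and>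
       List.null (third \<sigma> p (arc \<sigma> p)) \<and>
       list_ex1 (\<lambda>q. q mod n \<noteq> \<sigma> mod n \<and> arc \<sigma> q = p) [0..<N]) [0..<N]) [0..<N] \<and>
     list_all (\<lambda>\<sigma>. list_all (\<lambda>q. list_all (\<lambda>p.
       if p mod n = \<sigma> mod n \<and> q mod n = \<sigma> mod n \<or> p mod n \<noteq> \<sigma> mod n \<and> arc \<sigma> p = q \<or>
         q mod n \<noteq> \<sigma> mod n \<and> arc \<sigma> q = p then True
       else distinct (third \<sigma> p q) \<and> length (third \<sigma> p q) = 2) [0..<q]) [0..<N]) [0..<N] \<and>
     list_all (\<lambda>r. list_all (\<lambda>q. list_all (\<lambda>p. list_all (\<lambda>e.
       if p mod n = q mod n \<and> p mod n = r mod n then True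
       else list_ex1 (\<lambda>\<sigma>. List.member (third \<sigma> p q) (r, e)) [0..<N]) [0..<2]) [0..<q]) [0..<r]) [0..<N] \<and>
     list_all (\<lambda>p. list_all (\<lambda>q. if p mod n = q mod n then True
       else list_ex1 (\<lambda>\<sigma>. p mod n \<noteq> \<sigma> mod n \<and> arc \<sigma> p = q) [0..<N]) [0..<N]) [0..<N]"

lemma list_ex1_upt: "list_ex1 P [0..<N] \<longleftrightarrow> (\<exists>!x. x < N \<and> P x)"
  by (simp add: list_ex1_iff)

lemma tagged_frame_of_check:
  assumes c: "frame_check N n third arc" and n: "0 < n" "N = n * g"
  shows "tagged_frame N n g (\<lambda>\<sigma> p q r e. p < N \<and> q < N \<and> (r, e) \<in> set (third \<sigma> p q))
           (\<lambda>\<sigma> p q. p < N \<and> p mod n \<noteq> \<sigma> mod n \<and> arc \<sigma> p = q)"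
proof -
  have t: "r < N \<and> e < 2 \<and> p \<noteq> q \<and> (r, e) \<in> set (third \<sigma> q p) \<and> (q, e) \<in> set (third \<sigma> p r) \<and>
      (p mod n = q mod n \<longrightarrow> p mod n \<noteq> r mod n) \<and> (p mod n = \<sigma> mod n \<longrightarrow> q mod n \<noteq> \<sigma> mod n)"
    if "\<sigma> < N" "p < N" "q < N" "(r, e) \<in> set (third \<sigma> p q)" for \<sigma> p q r e
    using c that by (fastforce simp: frame_check_def list_all_iff)
  have a: "arc \<sigma> p < N \<and> arc \<sigma> p mod n \<noteq> p mod n \<and> arc \<sigma> p mod n \<noteq> \<sigma> mod n \<and> arc \<sigma> (arc \<sigma> p) \<noteq> p \<and>
      third \<sigma> p (arc \<sigma> p) = [] \<and> (\<exists>!q. q < N \<and> q mod n \<noteq> \<sigma> mod n \<and> arc \<sigma> q = p)"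
    if "\<sigma> < N" "p < N" "p mod n \<noteq> \<sigma> mod n" for \<sigma> p
    using c that by (simp add: frame_check_def list_all_iff list_ex1_upt cong: if_cong)
  have cov: "distinct (third \<sigma> p q) \<and> length (third \<sigma> p q) = 2"
    if "\<sigma> < N" "p < N" "q < N" "p < q" "p mod n \<noteq> \<sigma> mod n \<or> q mod n \<noteq> \<sigma> mod n"
      "\<not> (p mod n \<noteq> \<sigma> mod n \<and> arc \<sigma> p = q)" "\<not> (q mod n \<noteq> \<sigma> mod n \<and> arc \<sigma> q = p)" for \<sigma> p q
    using c that by (simp add: frame_check_def list_all_iff list_ex1_upt cong: if_cong)
  have to: "\<exists>!\<sigma>. \<sigma> < N \<and> (r, e) \<in> set (third \<sigma> p q)"
    if "p < q" "q < r" "r < N" "\<not> (p mod n = q mod n \<and> p mod n = r mod n)" "e < 2" for p q r e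
    using c that by (simp add: frame_check_def list_all_iff list_ex1_upt cong: if_cong)
  have ao: "\<exists>!\<sigma>. \<sigma> < N \<and> p mod n \<noteq> \<sigma> mod n \<and> arc \<sigma> p = q"
    if "p < N" "q < N" "p mod n \<noteq> q mod n" for p q
    using c that by (simp add: frame_check_def list_all_iff list_ex1_upt cong: if_cong)
  have sw: "(r, e) \<in> set (third \<sigma> p q) \<longleftrightarrow> (r, e) \<in> set (third \<sigma> q p)"
    if "\<sigma> < N" "p < N" "q < N" for \<sigma> p q r e
    using t that by blast
  have sw': "(r, e) \<in> set (third \<sigma> p q) \<longleftrightarrow> (q, e) \<in> set (third \<sigma> p r)"
    if "\<sigma> < N" "p < N" "q < N" "r < N" for \<sigma> p q r e
    using t that by blast
  have once: "\<exists>!\<sigma>. \<sigma> < N \<and> (r, e) \<in> set (third \<sigma> p q)"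
    if pqr: "p < N" "q < N" "r < N" "p \<noteq> q" "p \<noteq> r" "q \<noteq> r"
      "\<not> (p mod n = q mod n \<and> p mod n = r mod n)" "e < 2" for p q r e
  proof -
    define E where "E p q r \<longleftrightarrow> (\<exists>!\<sigma>. \<sigma> < N \<and> (r, e) \<in> set (third \<sigma> p q))" for p q r
    have E: "E p q r" if "p < q" "q < r" "r < N" "\<not> (p mod n = q mod n \<and> p mod n = r mod n)" for p q r
      unfolding E_def by (rule to[OF that \<open>e < 2\<close>])
    have e12: "E p q r \<longleftrightarrow> E q p r" if "p < N" "q < N" for p q r
      unfolding E_def using sw[OF _ that] by (intro arg_cong[where f=Ex1] ext conj_cong refl) auto
    have e23: "E p q r \<longleftrightarrow> E p r q" if "p < N" "q < N" "r < N" for p q r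
      unfolding E_def using sw'[OF _ that] by (intro arg_cong[where f=Ex1] ext conj_cong refl) auto
    consider "p < q \<and> q < r" | "p < r \<and> r < q" | "q < p \<and> p < r" | "q < r \<and> r < p" | "r < p \<and> p < q" | "r < q \<and> q < p"
      using pqr(4-6) by linarith
    then have "E p q r"
    proof cases
      case 1 then show ?thesis using E[of p q r] pqr by simp
    next
      case 2 then show ?thesis using E[of p r q] e23[OF pqr(1-3)] pqr by metis
    next
      case 3 then show ?thesis using E[of q p r] e12[OF pqr(1,2), of r] pqr by metis
    next
      case 4 then show ?thesis using E[of q r p] e12[OF pqr(1,2), of r] e23[OF pqr(2,1,3)] pqr by metis
    next
      case 5 then show ?thesis using E[of r p q] e23[OF pqr(1-3)] e12[OF pqr(1,3), of q] pqr by metis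
    next
      case 6 then show ?thesis
        using E[of r q p] e12[OF pqr(1,2), of r] e23[OF pqr(2,1,3)] e12[OF pqr(2,3), of p] pqr by metis
    qed
    then show ?thesis unfolding E_def .
  qed
  show ?thesis
  proof (unfold_locales, goal_cases)
    case (3 \<sigma> p q r e) then show ?case using t by blast
  next
    case (4 \<sigma> p q r e) then show ?case using t by blast
  next
    case (5 \<sigma> p q r e) then show ?case using t by blast
  next
    case (6 \<sigma> p q r e) then show ?case using t by blast
  next
    case (7 \<sigma> p q r e) then show ?case using t by blast
  next
    case (8 \<sigma> p q) then show ?case using a[of \<sigma> p] by auto
  next
    case (9 \<sigma> p q) then show ?case using a[of \<sigma> p] by auto
  next
    case (10 \<sigma> p q r e) then show ?case using a[of \<sigma> p] by auto
  next
    case (11 \<sigma> p q)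
    have card: "card (set (third \<sigma> p q)) = 2"
      if "p < q" "q < N" "p mod n \<noteq> \<sigma> mod n \<or> q mod n \<noteq> \<sigma> mod n"
        "\<not> (p mod n \<noteq> \<sigma> mod n \<and> arc \<sigma> p = q)" "\<not> (q mod n \<noteq> \<sigma> mod n \<and> arc \<sigma> q = p)" for p q
      using cov[OF \<open>\<sigma> < N\<close> _ that(2,1,3-5)] that(1,2) distinct_card[of "third \<sigma> p q"] by simp
    have "set (third \<sigma> p q) = set (third \<sigma> q p)" using sw[OF 11(1-3)] by auto
    moreover have "p < q \<or> q < p" using 11(4) by linarith
    ultimately have "card (set (third \<sigma> p q)) = 2"
      using card[of p q] card[of q p] 11(2,3,5-7) by metis
    moreover have "{(r, e). p < N \<and> q < N \<and> (r, e) \<in> set (third \<sigma> p q)} = set (third \<sigma> p q)"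
      using 11(2,3) by auto
    ultimately show ?case by simp
  next
    case (12 \<sigma> p) then show ?case by auto
  next
    case (13 \<sigma> p)
    then show ?case using a[of \<sigma> p] by simp
  next
    case (14 p q r e) then show ?case using once[of p q r e] by simp
  next
    case (15 p q)
    then show ?case using ao[of p q] by simp
  qed (use n in auto)
qed

definition shift_table ::
    "nat \<Rightarrow> (nat \<times> nat) list list list \<Rightarrow> nat \<Rightarrow> nat \<Rightarrow> nat \<Rightarrow> (nat \<times> nat) list" where
  "shift_table N t \<sigma> p q =
     map (\<lambda>(r, e). ((r + \<sigma>) mod N, e)) (t ! ((p + (N - \<sigma>)) mod N) ! ((q + (N - \<sigma>)) mod N))"

definition shift_arc :: "nat \<Rightarrow> nat list \<Rightarrow> nat \<Rightarrow> nat \<Rightarrow> nat" where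
  "shift_arc N a \<sigma> p = (a ! ((p + (N - \<sigma>)) mod N) + \<sigma>) mod N"

text \<open>Found by computer search: entry \<open>(x, y)\<close> of a table lists all \<open>(z, e)\<close> such that the tagged
  triple \<open>({x, y, z}, e)\<close> is in system 0, whose arcs are \<open>(x, arcs ! x)\<close>; the entries of the arc list
  at points of the hole are junk. System \<open>\<sigma>\<close> is the translate by \<open>\<sigma>\<close>.\<close>

definition table4 :: "(nat \<times> nat) list list list" where
  "table4 =
   [[[], [(6, 0), (7, 0)], [(3, 1), (7, 0)], [(2, 1), (5, 0)], [], [(3, 0), (6, 1)], [(1, 0), (5, 1)], [(1, 0), (2, 0)]],
    [[(6, 0), (7, 0)], [], [], [], [(5, 0), (7, 1)], [(4, 0), (6, 0)], [(0, 0), (5, 0)], [(0, 0), (4, 1)]],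
    [[(3, 1), (7, 0)], [], [], [(0, 1), (7, 1)], [(6, 0), (6, 1)], [], [(4, 0), (4, 1)], [(0, 0), (3, 1)]],
    [[(2, 1), (5, 0)], [], [(0, 1), (7, 1)], [], [(5, 1), (7, 1)], [(0, 0), (4, 1)], [], [(2, 1), (4, 1)]],
    [[], [(5, 0), (7, 1)], [(6, 0), (6, 1)], [(5, 1), (7, 1)], [], [(1, 0), (3, 1)], [(2, 0), (2, 1)], [(1, 1), (3, 1)]],
    [[(3, 0), (6, 1)], [(4, 0), (6, 0)], [], [(0, 0), (4, 1)], [(1, 0), (3, 1)], [], [(0, 1), (1, 0)], []],
    [[(1, 0), (5, 1)], [(0, 0), (5, 0)], [(4, 0), (4, 1)], [], [(2, 0), (2, 1)], [(0, 1), (1, 0)], [], []],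
    [[(1, 0), (2, 0)], [(0, 0), (4, 1)], [(0, 0), (3, 1)], [(2, 1), (4, 1)], [(1, 1), (3, 1)], [], [], []]]"

definition arcs4 :: "nat list" where
  "arcs4 = [0, 2, 5, 1, 0, 7, 3, 6]"

lemma frame_check4: "frame_check 8 4 (shift_table 8 table4) (shift_arc 8 arcs4)"
  by code_simp

definition table3 :: "(nat \<times> nat) list list list" where
  "table3 =
   [[[], [(8, 0), (8, 1)], [(7, 0), (7, 1)], [], [(5, 0), (5, 1)], [(4, 0), (4, 1)], [], [(2, 0), (2, 1)], [(1, 0), (1, 1)]],
    [[(8, 0), (8, 1)], [], [], [(4, 0), (7, 0)], [(3, 0), (6, 1)], [], [(4, 1), (7, 0)], [(3, 0), (6, 0)], [(0, 0), (0, 1)]],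
    [[(7, 0), (7, 1)], [], [], [(5, 0), (8, 0)], [], [(3, 0), (6, 1)], [(5, 1), (8, 0)], [(0, 0), (0, 1)], [(3, 0), (6, 0)]],
    [[], [(4, 0), (7, 0)], [(5, 0), (8, 0)], [], [(1, 0), (7, 1)], [(2, 0), (8, 1)], [], [(1, 0), (4, 1)], [(2, 0), (5, 1)]],
    [[(5, 0), (5, 1)], [(3, 0), (6, 1)], [], [(1, 0), (7, 1)], [], [(0, 0), (0, 1)], [(1, 1), (7, 1)], [(3, 1), (6, 1)], []],
    [[(4, 0), (4, 1)], [], [(3, 0), (6, 1)], [(2, 0), (8, 1)], [(0, 0), (0, 1)], [], [(2, 1), (8, 1)], [], [(3, 1), (6, 1)]],
    [[], [(4, 1), (7, 0)], [(5, 1), (8, 0)], [], [(1, 1), (7, 1)], [(2, 1), (8, 1)], [], [(1, 0), (4, 1)], [(2, 0), (5, 1)]],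
    [[(2, 0), (2, 1)], [(3, 0), (6, 0)], [(0, 0), (0, 1)], [(1, 0), (4, 1)], [(3, 1), (6, 1)], [], [(1, 0), (4, 1)], [], []],
    [[(1, 0), (1, 1)], [(0, 0), (0, 1)], [(3, 0), (6, 0)], [(2, 0), (5, 1)], [], [(3, 1), (6, 1)], [(2, 0), (5, 1)], [], []]]"

definition arcs3 :: "nat list" where
  "arcs3 = [0, 2, 4, 0, 8, 1, 0, 5, 7]"

lemma frame_check3: "frame_check 9 3 (shift_table 9 table3) (shift_arc 9 arcs3)"
  by code_simp

section \<open>The recursion\<close>

lemma LS_exists_mult_coprime6:
  assumes "3 \<in> K" "\<And>k. k \<in> K \<Longrightarrow> 3 \<le> k" "0 < h" "0 < n" "coprime n 6" "LS_exists K (2 * h + 2)"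
  shows "LS_exists K (n * (2 * h) + 2)"
  by (rule tagged_frame.LS_exists_inflate[OF tagged_frame_coprime6]) (use assms in auto)

lemma LS_exists_mult_3:
  assumes "3 \<in> K" "\<And>k. k \<in> K \<Longrightarrow> 3 \<le> k" "0 < h" "LS_exists K (6 * h + 2)"
  shows "LS_exists K (18 * h + 2)"
proof -
  have "tagged_frame 9 3 3 (\<lambda>\<sigma> p q r e. p < 9 \<and> q < 9 \<and> (r, e) \<in> set (shift_table 9 table3 \<sigma> p q))
      (\<lambda>\<sigma> p q. p < 9 \<and> p mod 3 \<noteq> \<sigma> mod 3 \<and> shift_arc 9 arcs3 \<sigma> p = q)"
    by (rule tagged_frame_of_check[OF frame_check3]) simp_all
  from tagged_frame.LS_exists_inflate[OF this assms(1,2,3)] assms(4) show ?thesis by simp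
qed

lemma LS_exists_mult_4:
  assumes "3 \<in> K" "\<And>k. k \<in> K \<Longrightarrow> 3 \<le> k" "0 < h" "LS_exists K (4 * h + 2)"
  shows "LS_exists K (16 * h + 2)"
proof -
  have "tagged_frame 8 4 2 (\<lambda>\<sigma> p q r e. p < 8 \<and> q < 8 \<and> (r, e) \<in> set (shift_table 8 table4 \<sigma> p q))
      (\<lambda>\<sigma> p q. p < 8 \<and> p mod 4 \<noteq> \<sigma> mod 4 \<and> shift_arc 8 arcs4 \<sigma> p = q)"
    by (rule tagged_frame_of_check[OF frame_check4]) simp_all
  from tagged_frame.LS_exists_inflate[OF this assms(1,2,3)] assms(4) show ?thesis by simp
qed

lemma coprime_6I:
  fixes n :: nat
  assumes "odd n" "\<not> 3 dvd n"
  shows "coprime n 6"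
proof -
  have "n mod 3 = 1 \<or> n mod 3 = 2" using assms(2) by presburger
  then have "coprime (n mod 3) 3"
    by (elim disjE) (simp_all add: coprime_iff_gcd_eq_1 gcd_non_0_nat)
  then have "coprime n 3" by simp
  moreover have "coprime n 2" using assms(1) by simp
  ultimately show ?thesis using coprime_mult_right_iff[of n 2 3] by simp
qed

lemma LS_exists_3_8: "odd n \<Longrightarrow> LS_exists {3, 8} (6 * n + 2)"
proof (induction n rule: less_induct)
  case (less n)
  have K: "3 \<in> {3, 8::nat}" "\<And>k. k \<in> {3, 8::nat} \<Longrightarrow> 3 \<le> k" by auto
  show ?case
  proof (cases "3 dvd n")
    case True
    then obtain k where k: "n = 3 * k" ..
    with less.prems have "0 < k" "odd k" by (auto intro: Nat.gr0I)
    then show ?thesis using LS_exists_mult_3[OF K, of k] less.IH[of k] k by simp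
  next
    case False
    have "LS_exists {3, 8} 8" by (rule LS_exists_one_block) auto
    then show ?thesis
      using LS_exists_mult_coprime6[OF K, of 3 n] coprime_6I[OF less.prems False] odd_pos[OF less.prems]
      by (simp add: mult.commute)
  qed
qed

lemma LS_exists_3_14_26:
  assumes K: "3 \<in> K" "\<And>k. k \<in> K \<Longrightarrow> 3 \<le> k" "14 \<in> K" "26 \<in> K"
  shows "LS_exists K (12 * n + 2)"
proof (induction n rule: less_induct)
  case (less n)
  have base: "LS_exists K 14" "LS_exists K 26"
    using LS_exists_one_block[OF K(2)] K(3,4) by auto
  consider "n = 0" | "n \<noteq> 0" "3 dvd n" | "n \<noteq> 0" "4 dvd n" | "odd n" "\<not> 3 dvd n" | b where "n = 2 * b" "odd b" "\<not> 3 dvd b"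
  proof -
    have "4 dvd n \<or> odd n \<or> (\<exists>b. n = 2 * b \<and> odd b)"
    proof (cases "even n")
      case True
      then obtain b where b: "n = 2 * b" ..
      show ?thesis
      proof (cases "even b")
        case True
        then obtain c where "b = 2 * c" ..
        then have "n = 4 * c" using b by simp
        then show ?thesis by simp
      qed (use b in blast)
    qed simp
    moreover have "3 dvd 2 * b" if "3 dvd b" for b :: nat using that by simp
    ultimately show thesis using that by metis
  qed
  then show ?case
  proof cases
    case 1
    then show ?thesis using LS_exists_two[of K, OF K(2)] by (simp add: numeral_2_eq_2)
  next
    case 2
    then obtain k where "n = 3 * k" by (auto elim: dvdE)
    then show ?thesis using LS_exists_mult_3[OF K(1,2), of "2 * k"] less.IH[of k] 2 by simp
  next
    case 3
    then obtain k where "n = 4 * k" by (auto elim: dvdE)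
    then show ?thesis using LS_exists_mult_4[OF K(1,2), of "3 * k"] less.IH[of k] 3 by simp
  next
    case 4
    then show ?thesis
      using LS_exists_mult_coprime6[OF K(1,2), of 6 n] coprime_6I odd_pos base(1) by (simp add: mult.commute)
  next
    case (5 b)
    then show ?thesis
      using LS_exists_mult_coprime6[OF K(1,2), of 12 b] coprime_6I odd_pos base(2) by (simp add: mult.commute)
  qed
qed

theorem theorem2p11:
  shows "(\<forall>v::nat. [v = 8] (mod 12) \<longrightarrow>
            (\<exists>(X :: nat set) (R :: nat set) (\<B> :: nat \<Rightarrow> nat set multiset).
               is_LS_star 2 {3, 8} v X R \<B>)) \<and>
         (\<forall>v::nat. [v = 2] (mod 12) \<longrightarrow>
            (\<exists>(X :: nat set) (R :: nat set) (\<B> :: nat \<Rightarrow> nat set multiset).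
               is_LS_star 2 {3, 14, 26, 50, 98} v X R \<B>))"
proof (intro conjI allI impI)
  fix v :: nat assume "[v = 8] (mod 12)"
  then have "v = 6 * (2 * (v div 12) + 1) + 2" by (simp add: cong_def) presburger
  moreover have "LS_exists {3, 8} (6 * (2 * (v div 12) + 1) + 2)" by (rule LS_exists_3_8) simp
  ultimately have "LS_exists {3, 8} v" by (simp only:)
  then show "\<exists>(X :: nat set) (R :: nat set) \<B>. is_LS_star 2 {3, 8} v X R \<B>"
    unfolding LS_exists_def by blast
next
  fix v :: nat assume "[v = 2] (mod 12)"
  then have "v = 12 * (v div 12) + 2" by (simp add: cong_def) presburger
  moreover have "LS_exists {3, 14, 26, 50, 98} (12 * (v div 12) + 2)"
    by (rule LS_exists_3_14_26) auto
  ultimately have "LS_exists {3, 14, 26, 50, 98} v" by (simp only:)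
  then show "\<exists>(X :: nat set) (R :: nat set) \<B>. is_LS_star 2 {3, 14, 26, 50, 98} v X R \<B>"
    unfolding LS_exists_def by blast
qed

end
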